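(* Let $\nu_d=\mathrm{Uniform}([0,1]^d)$ and $\mathcal{T}=\{f\in L_2(\nu_d):\|f\|_\infty\le3\}$. For any $\delta_\mu^{\mathrm{appr}}\in[0,1]$, $n\ge18$, and $m,s\in\mathbb{N}^+$ satisfying $m\ge n^3$ and $\frac{s[\log(m/s)+1]}{n}\le1$, there exists a set of orthogonal basis functions $\phi(X)=(\phi_1(X),\dots,\phi_m(X))^\top\in\mathbb{R}^m$ with $\mathbb{E}_{X\sim\nu_d}[\phi(X)\phi(X)^\top]=I_m$ such that the class $$\mathcal{F}_\mu=\bigcup_{g\in\mathcal{G}_\mu}\mathcal{B}(g,\delta_\mu^{\mathrm{appr}}),\qquad \mathcal{G}_\mu=\Big\{g(x)=\sum_{j=1}^m\alpha_j\phi_j(x)\in\mathcal{T}:\ \|\alpha\|_0\le s\Big\},$$ where $\mathcal{B}(g,\delta)=\{f\in\mathcal{T}:\|f-g\|_{L_2(\nu_d)}\le\delta\}$, satisfies $$\inf_{\hat\theta}\ \sup_{\mathbb{P}\in\mathcal{P}_\mu(\mathcal{F}_\mu)}\mathbb{E}_{\mathbb{P}^{2n}}\big[|\hat\theta-\theta(\mathbb{P})|\big]\ \ge\ \frac{1}{211}\left[n^{-1/2}+\delta_\mu^{\mathrm{appr}}+\frac{s\log(m/s)}{n}\right].$$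
   Context: $\|\alpha\|_0$ is the number of nonzero entries of $\alpha\in\mathbb{R}^m$. For $\mathcal{F}_\mu\subseteq\mathcal{T}$, $\mathcal{P}_\mu(\mathcal{F}_\mu)$ is the set of laws $\mathbb{P}=\mathbb{P}_{\beta,v,\mu,\pi}$ of $(X,T,Y)$ with $\mu\in\mathcal{F}_\mu$, $\pi\in\mathcal{T}$, $|\beta|\vee|v|\le3$, $|T|\vee|Y|\le3$, such that $X\sim\nu_d$; $T=\pi(X)+u$ with $\mathbb{E}[u\mid X]=0$ and $\mathbb{E}[u^2\mid X]\equiv v\ge1/3$; $Y=T\beta+\mu(X)+\varepsilon$ with $\mathbb{E}[\varepsilon\mid X,T]=0$. The target is $\theta(\mathbb{P}_{\beta,v,\mu,\pi})=\beta$. $\mathbb{E}_{\mathbb{P}^{2n}}$ is over $2n$ i.i.d. observations from $\mathbb{P}$, and the infimum is over all estimators $\hat\theta$ that are functions of these $2n$ observations (and may depend on $\mathcal{F}_\mu$). *)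

theory Defs
  imports "HOL-Probability.Probability"
begin

definition nu :: "(real ^ 'd) measure" where
  "nu = uniform_measure lborel {x. \<forall>i. 0 \<le> x $ i \<and> x $ i \<le> 1}"

text \<open>Elements of \<open>L\<^sub>2\<close> are represented by Borel functions that are not identified almost everywhere;
  the classes \<open>T_class\<close>, \<open>T_ball\<close> and \<open>F_class\<close> are invariant under modification on a null set.\<close>

definition L2_space :: "'a measure \<Rightarrow> ('a \<Rightarrow> real) set" where
  "L2_space M = {f \<in> borel_measurable M. integrable M (\<lambda>x. (f x)\<^sup>2)}"

definition L2_norm :: "'a measure \<Rightarrow> ('a \<Rightarrow> real) \<Rightarrow> real" where
  "L2_norm M f = sqrt (\<integral>x. (f x)\<^sup>2 \<partial>M)"

definition T_class :: "(real ^ 'd \<Rightarrow> real) set" where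
  "T_class = {f \<in> L2_space nu. esssup nu (\<lambda>x. ereal \<bar>f x\<bar>) \<le> 3}"

definition orthonormal_basis_functions :: "nat \<Rightarrow> (nat \<Rightarrow> real ^ 'd \<Rightarrow> real) \<Rightarrow> bool" where
  "orthonormal_basis_functions m \<phi> \<longleftrightarrow>
     (\<forall>j\<in>{1..m}. \<phi> j \<in> L2_space nu) \<and>
     (\<forall>i\<in>{1..m}. \<forall>j\<in>{1..m}. (\<integral>x. \<phi> i x * \<phi> j x \<partial>nu) = (if i = j then 1 else 0))"

definition l0_norm :: "nat \<Rightarrow> (nat \<Rightarrow> real) \<Rightarrow> nat" where
  "l0_norm m \<alpha> = card {j \<in> {1..m}. \<alpha> j \<noteq> 0}"

definition G_class :: "nat \<Rightarrow> nat \<Rightarrow> (nat \<Rightarrow> real ^ 'd \<Rightarrow> real) \<Rightarrow> (real ^ 'd \<Rightarrow> real) set" where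
  "G_class m s \<phi> = {g \<in> T_class. \<exists>\<alpha>. g = (\<lambda>x. \<Sum>j=1..m. \<alpha> j * \<phi> j x) \<and> l0_norm m \<alpha> \<le> s}"

definition T_ball :: "(real ^ 'd \<Rightarrow> real) \<Rightarrow> real \<Rightarrow> (real ^ 'd \<Rightarrow> real) set" where
  "T_ball g \<delta> = {f \<in> T_class. L2_norm nu (\<lambda>x. f x - g x) \<le> \<delta>}"

definition F_class ::
  "nat \<Rightarrow> nat \<Rightarrow> real \<Rightarrow> (nat \<Rightarrow> real ^ 'd \<Rightarrow> real) \<Rightarrow> (real ^ 'd \<Rightarrow> real) set" where
  "F_class m s \<delta> \<phi> = (\<Union>g \<in> G_class m s \<phi>. T_ball g \<delta>)"

text \<open>An observation is a triple \<open>(x, t, y)\<close>.\<close>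

type_synonym 'd obs = "(real ^ 'd) \<times> real \<times> real"

definition sigma_X :: "('d::finite) obs measure \<Rightarrow> 'd obs measure" where
  "sigma_X P = vimage_algebra (space P) (\<lambda>(x, t, y). x) borel"

definition sigma_XT :: "('d::finite) obs measure \<Rightarrow> 'd obs measure" where
  "sigma_XT P = vimage_algebra (space P) (\<lambda>(x, t, y). (x, t)) borel"

text \<open>\<open>plm_law \<beta> v \<mu> \<pi> P\<close> says that \<open>P\<close> is a law \<open>\<P>\<close> with parameters \<open>(\<beta>, v, \<mu>, \<pi>)\<close>.
  This is a relation because the parameters leave the distributions of the noise terms
  \<open>u = T - \<pi>(X)\<close> and \<open>\<epsilon> = Y - T \<beta> - \<mu>(X)\<close> open.\<close>

definition plm_law ::
  "real \<Rightarrow> real \<Rightarrow> (real ^ 'd \<Rightarrow> real) \<Rightarrow> (real ^ 'd \<Rightarrow> real) \<Rightarrow> ('d::finite) obs measure \<Rightarrow> bool" where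
  "plm_law \<beta> v \<mu> \<pi> P \<longleftrightarrow>
     prob_space P \<and> sets P = sets borel \<and>
     max \<bar>\<beta>\<bar> \<bar>v\<bar> \<le> 3 \<and> v \<ge> 1/3 \<and>
     (AE (x, t, y) in P. max \<bar>t\<bar> \<bar>y\<bar> \<le> 3) \<and>
     distr P borel (\<lambda>(x, t, y). x) = nu \<and>
     (AE \<omega> in P. real_cond_exp P (sigma_X P) (\<lambda>(x, t, y). t - \<pi> x) \<omega> = 0) \<and>
     (AE \<omega> in P. real_cond_exp P (sigma_X P) (\<lambda>(x, t, y). (t - \<pi> x)\<^sup>2) \<omega> = v) \<and>
     (AE \<omega> in P. real_cond_exp P (sigma_XT P) (\<lambda>(x, t, y). y - t * \<beta> - \<mu> x) \<omega> = 0)"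

definition P_class :: "(real ^ 'd \<Rightarrow> real) set \<Rightarrow> ('d::finite) obs measure set" where
  "P_class F = {P. \<exists>\<beta> v \<mu> \<pi>. \<mu> \<in> F \<and> \<pi> \<in> T_class \<and> plm_law \<beta> v \<mu> \<pi> P}"

text \<open>The parameter \<open>\<beta>\<close> is determined by the law; see \<open>theta_eq\<close> below.\<close>

definition theta :: "('d::finite) obs measure \<Rightarrow> real" where
  "theta P = (THE \<beta>. \<exists>v \<mu> \<pi>. \<mu> \<in> T_class \<and> \<pi> \<in> T_class \<and> plm_law \<beta> v \<mu> \<pi> P)"

definition estimators :: "nat \<Rightarrow> ((nat \<Rightarrow> ('d::finite) obs) \<Rightarrow> real) set" where
  "estimators N = borel_measurable (Pi\<^sub>M {..<N} (\<lambda>_. borel))"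

text \<open>The risks are valued in \<open>ennreal\<close>, so that no integrability is imposed on the estimators.\<close>

definition minimax_risk :: "nat \<Rightarrow> ('d::finite) obs measure set \<Rightarrow> ennreal" where
  "minimax_risk N \<P> =
     (INF \<theta>' \<in> estimators N. SUP P \<in> \<P>.
        \<integral>\<^sup>+ \<omega>. ennreal \<bar>\<theta>' \<omega> - theta P\<bar> \<partial>(Pi\<^sub>M {..<N} (\<lambda>_. P)))"

lemma T_class_measurable: "f \<in> T_class \<Longrightarrow> f \<in> borel_measurable borel"
  by (simp add: T_class_def L2_space_def nu_def cong: measurable_cong_sets)

lemma T_class_bounded:
  assumes "f \<in> T_class"
  shows "AE x in nu. \<bar>f x\<bar> \<le> 3"
proof -
  have "AE x in nu. ereal \<bar>f x\<bar> \<le> esssup nu (\<lambda>x. ereal \<bar>f x\<bar>)"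
    by (rule esssup_AE)
  then show ?thesis
  proof (rule AE_mp, intro AE_I2 impI)
    fix x assume "ereal \<bar>f x\<bar> \<le> esssup nu (\<lambda>x. ereal \<bar>f x\<bar>)"
    also have "\<dots> \<le> 3" using assms by (simp add: T_class_def)
    finally show "\<bar>f x\<bar> \<le> 3" by simp
  qed
qed

context
  fixes \<beta> v :: real and \<mu> \<pi> :: "real ^ 'd \<Rightarrow> real" and P :: "('d::finite) obs measure"
  assumes law: "plm_law \<beta> v \<mu> \<pi> P" and \<mu>: "\<mu> \<in> T_class" and \<pi>: "\<pi> \<in> T_class"
begin

private abbreviation "X \<equiv> \<lambda>\<omega>::'d obs. fst \<omega>"
private abbreviation "T \<equiv> \<lambda>\<omega>::'d obs. fst (snd \<omega>)"
private abbreviation "Y \<equiv> \<lambda>\<omega>::'d obs. snd (snd \<omega>)"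

lemma plm_law_sets: "sets P = sets borel"
  using law by (simp add: plm_law_def)

lemma plm_law_prob_space: "prob_space P"
  using law by (simp add: plm_law_def)

lemma plm_law_measurable:
  "X \<in> borel_measurable P" "T \<in> borel_measurable P" "Y \<in> borel_measurable P"
  by (simp_all add: measurable_cong_sets[OF plm_law_sets refl] borel_prod[symmetric])

lemma plm_law_comp_measurable:
  "f \<in> T_class \<Longrightarrow> (\<lambda>\<omega>. f (X \<omega>)) \<in> borel_measurable P"
  by (rule measurable_compose[OF plm_law_measurable(1) T_class_measurable])

lemma plm_law_subalgebra:
  "subalgebra P (sigma_X P)" "subalgebra P (sigma_XT P)"
proof -
  have *: "(\<lambda>(x, t, y). x) \<in> P \<rightarrow>\<^sub>M borel"
    using plm_law_measurable(1) by (simp add: case_prod_beta')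
  have "sets (sigma_X P) \<subseteq> sets P"
    unfolding sigma_X_def by (rule sets_image_in_sets[OF refl *])
  then show "subalgebra P (sigma_X P)"
    by (simp add: subalgebra_def sigma_X_def)
  have **: "(\<lambda>(x, t, y). (x, t)) \<in> P \<rightarrow>\<^sub>M borel"
    using plm_law_measurable(1,2) by (simp add: case_prod_beta' borel_prod[symmetric])
  have "sets (sigma_XT P) \<subseteq> sets P"
    unfolding sigma_XT_def by (rule sets_image_in_sets[OF refl **])
  then show "subalgebra P (sigma_XT P)"
    by (simp add: subalgebra_def sigma_XT_def)
qed

lemma plm_law_sigma_finite:
  "sigma_finite_subalgebra P (sigma_X P)" "sigma_finite_subalgebra P (sigma_XT P)"
  using plm_law_subalgebra prob_space.finite_measure[OF plm_law_prob_space]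
  by (auto intro!: finite_measure_subalgebra_is_sigma_finite
      simp: finite_measure_subalgebra_def finite_measure_subalgebra_axioms_def)

lemma plm_law_X_measurable: "X \<in> sigma_X P \<rightarrow>\<^sub>M borel"
proof -
  have "(\<lambda>(x, t, y). x) \<in> sigma_X P \<rightarrow>\<^sub>M borel"
    unfolding sigma_X_def by (rule measurable_vimage_algebra1) auto
  then show ?thesis by (simp add: case_prod_beta')
qed

lemma plm_law_XT_measurable: "X \<in> sigma_XT P \<rightarrow>\<^sub>M borel" "T \<in> sigma_XT P \<rightarrow>\<^sub>M borel"
proof -
  have *: "(\<lambda>(x, t, y). (x, t)) \<in> sigma_XT P \<rightarrow>\<^sub>M borel"
    unfolding sigma_XT_def by (rule measurable_vimage_algebra1) auto
  show "X \<in> sigma_XT P \<rightarrow>\<^sub>M borel" "T \<in> sigma_XT P \<rightarrow>\<^sub>M borel"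
    using measurable_compose[OF *, of fst borel] measurable_compose[OF *, of snd borel]
    by (simp_all add: case_prod_beta' borel_prod[symmetric])
qed

lemma plm_law_bounded:
  "AE \<omega> in P. \<bar>T \<omega>\<bar> \<le> 3 \<and> \<bar>Y \<omega>\<bar> \<le> 3"
  using law by (simp add: plm_law_def case_prod_beta')

lemma plm_law_comp_bounded:
  assumes "f \<in> T_class"
  shows "AE \<omega> in P. \<bar>f (X \<omega>)\<bar> \<le> 3"
proof (rule AE_distrD[OF plm_law_measurable(1)])
  have "distr P borel X = nu"
    using law by (simp add: plm_law_def case_prod_beta')
  then show "AE x in distr P borel X. \<bar>f x\<bar> \<le> 3"
    using T_class_bounded[OF assms] by (simp only:)
qed

lemma plm_law_integrable_mult:
  fixes f g :: "'d obs \<Rightarrow> real"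
  assumes "f \<in> borel_measurable P" "g \<in> borel_measurable P"
    and "AE \<omega> in P. \<bar>f \<omega>\<bar> \<le> a" "AE \<omega> in P. \<bar>g \<omega>\<bar> \<le> b"
  shows "integrable P (\<lambda>\<omega>. f \<omega> * g \<omega>)"
proof (rule finite_measure.integrable_const_bound)
  show "AE \<omega> in P. norm (f \<omega> * g \<omega>) \<le> a * b"
    using assms(3,4) by eventually_elim (auto simp: abs_mult intro!: mult_mono)
qed (use assms prob_space.finite_measure[OF plm_law_prob_space] in auto)

lemma plm_law_u_bounded: "AE \<omega> in P. \<bar>T \<omega> - \<pi> (X \<omega>)\<bar> \<le> 6"
  using plm_law_bounded plm_law_comp_bounded[OF \<pi>] by eventually_elim auto

lemma plm_law_u_measurable: "(\<lambda>\<omega>. T \<omega> - \<pi> (X \<omega>)) \<in> borel_measurable P"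
  using plm_law_measurable plm_law_comp_measurable[OF \<pi>] by simp

lemma plm_law_u_orthogonal:
  assumes f: "f \<in> T_class"
  shows "integrable P (\<lambda>\<omega>. f (X \<omega>) * (T \<omega> - \<pi> (X \<omega>)))"
    and "(\<integral>\<omega>. f (X \<omega>) * (T \<omega> - \<pi> (X \<omega>)) \<partial>P) = 0"
proof -
  show int: "integrable P (\<lambda>\<omega>. f (X \<omega>) * (T \<omega> - \<pi> (X \<omega>)))"
    by (rule plm_law_integrable_mult[OF plm_law_comp_measurable[OF f] plm_law_u_measurable
          plm_law_comp_bounded[OF f] plm_law_u_bounded])
  interpret sigma_finite_subalgebra P "sigma_X P" by (rule plm_law_sigma_finite)
  have "(\<integral>\<omega>. f (X \<omega>) * (T \<omega> - \<pi> (X \<omega>)) \<partial>P) =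
      (\<integral>\<omega>. f (X \<omega>) * real_cond_exp P (sigma_X P) (\<lambda>\<omega>. T \<omega> - \<pi> (X \<omega>)) \<omega> \<partial>P)"
    by (rule real_cond_exp_intg(2)[symmetric, OF int
          measurable_compose[OF plm_law_X_measurable T_class_measurable[OF f]]
          plm_law_u_measurable])
  also have "\<dots> = (\<integral>\<omega>. 0 \<partial>P)"
  proof (rule integral_cong_AE)
    show "AE \<omega> in P. f (X \<omega>) * real_cond_exp P (sigma_X P) (\<lambda>\<omega>. T \<omega> - \<pi> (X \<omega>)) \<omega> = 0"
      using law by (auto simp: plm_law_def case_prod_beta')
  qed (use plm_law_comp_measurable[OF f] in auto)
  finally show "(\<integral>\<omega>. f (X \<omega>) * (T \<omega> - \<pi> (X \<omega>)) \<partial>P) = 0" by simp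
qed

lemma plm_law_u_square:
  shows "integrable P (\<lambda>\<omega>. (T \<omega> - \<pi> (X \<omega>))\<^sup>2)"
    and "(\<integral>\<omega>. (T \<omega> - \<pi> (X \<omega>))\<^sup>2 \<partial>P) = v"
proof -
  show int: "integrable P (\<lambda>\<omega>. (T \<omega> - \<pi> (X \<omega>))\<^sup>2)"
    unfolding power2_eq_square
    by (rule plm_law_integrable_mult[OF plm_law_u_measurable plm_law_u_measurable
          plm_law_u_bounded plm_law_u_bounded])
  interpret sigma_finite_subalgebra P "sigma_X P" by (rule plm_law_sigma_finite)
  interpret prob_space P by (rule plm_law_prob_space)
  have "(\<integral>\<omega>. (T \<omega> - \<pi> (X \<omega>))\<^sup>2 \<partial>P) =
      (\<integral>\<omega>. real_cond_exp P (sigma_X P) (\<lambda>\<omega>. (T \<omega> - \<pi> (X \<omega>))\<^sup>2) \<omega> \<partial>P)"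
    by (rule real_cond_exp_int(2)[symmetric, OF int])
  also have "\<dots> = (\<integral>\<omega>. v \<partial>P)"
    by (rule integral_cong_AE) (use law in \<open>auto simp: plm_law_def case_prod_beta'\<close>)
  finally show "(\<integral>\<omega>. (T \<omega> - \<pi> (X \<omega>))\<^sup>2 \<partial>P) = v" by (simp add: prob_space)
qed

lemma plm_law_eps_orthogonal:
  shows "integrable P (\<lambda>\<omega>. (T \<omega> - \<pi> (X \<omega>)) * (Y \<omega> - T \<omega> * \<beta> - \<mu> (X \<omega>)))"
    and "(\<integral>\<omega>. (T \<omega> - \<pi> (X \<omega>)) * (Y \<omega> - T \<omega> * \<beta> - \<mu> (X \<omega>)) \<partial>P) = 0"
proof -
  have meas: "(\<lambda>\<omega>. Y \<omega> - T \<omega> * \<beta> - \<mu> (X \<omega>)) \<in> borel_measurable P"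
    using plm_law_measurable plm_law_comp_measurable[OF \<mu>] by simp
  have bd: "AE \<omega> in P. \<bar>Y \<omega> - T \<omega> * \<beta> - \<mu> (X \<omega>)\<bar> \<le> 3 + 3 * \<bar>\<beta>\<bar> + 3"
    using plm_law_bounded plm_law_comp_bounded[OF \<mu>]
  proof eventually_elim
    case (elim \<omega>)
    have "\<bar>T \<omega> * \<beta>\<bar> \<le> 3 * \<bar>\<beta>\<bar>"
      using elim by (auto simp: abs_mult intro!: mult_right_mono)
    then show ?case using elim by linarith
  qed
  show int: "integrable P (\<lambda>\<omega>. (T \<omega> - \<pi> (X \<omega>)) * (Y \<omega> - T \<omega> * \<beta> - \<mu> (X \<omega>)))"
    by (rule plm_law_integrable_mult[OF plm_law_u_measurable meas plm_law_u_bounded bd])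
  interpret sigma_finite_subalgebra P "sigma_XT P" by (rule plm_law_sigma_finite)
  have uF: "(\<lambda>\<omega>. T \<omega> - \<pi> (X \<omega>)) \<in> borel_measurable (sigma_XT P)"
    using plm_law_XT_measurable(2)
      measurable_compose[OF plm_law_XT_measurable(1) T_class_measurable[OF \<pi>]] by simp
  have "(\<integral>\<omega>. (T \<omega> - \<pi> (X \<omega>)) * (Y \<omega> - T \<omega> * \<beta> - \<mu> (X \<omega>)) \<partial>P) =
      (\<integral>\<omega>. (T \<omega> - \<pi> (X \<omega>)) *
        real_cond_exp P (sigma_XT P) (\<lambda>\<omega>. Y \<omega> - T \<omega> * \<beta> - \<mu> (X \<omega>)) \<omega> \<partial>P)"
    by (rule real_cond_exp_intg(2)[symmetric, OF int uF meas])
  also have "\<dots> = (\<integral>\<omega>. 0 \<partial>P)"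
  proof (rule integral_cong_AE)
    show "AE \<omega> in P. (T \<omega> - \<pi> (X \<omega>)) *
        real_cond_exp P (sigma_XT P) (\<lambda>\<omega>. Y \<omega> - T \<omega> * \<beta> - \<mu> (X \<omega>)) \<omega> = 0"
      using law by (auto simp: plm_law_def case_prod_beta')
  qed (use plm_law_u_measurable in auto)
  finally show "(\<integral>\<omega>. (T \<omega> - \<pi> (X \<omega>)) * (Y \<omega> - T \<omega> * \<beta> - \<mu> (X \<omega>)) \<partial>P) = 0" by simp
qed

lemma plm_law_cov: "(\<integral>\<omega>. (T \<omega> - \<pi> (X \<omega>)) * Y \<omega> \<partial>P) = \<beta> * v"
proof -
  have "(\<integral>\<omega>. (T \<omega> - \<pi> (X \<omega>)) * Y \<omega> \<partial>P) =
      (\<integral>\<omega>. \<beta> * (T \<omega> - \<pi> (X \<omega>))\<^sup>2 + (\<beta> * (\<pi> (X \<omega>) * (T \<omega> - \<pi> (X \<omega>))) +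
        (\<mu> (X \<omega>) * (T \<omega> - \<pi> (X \<omega>)) +
        (T \<omega> - \<pi> (X \<omega>)) * (Y \<omega> - T \<omega> * \<beta> - \<mu> (X \<omega>)))) \<partial>P)"
    by (rule Bochner_Integration.integral_cong) (auto simp: algebra_simps power2_eq_square)
  also have "\<dots> = \<beta> * v"
    using plm_law_u_square plm_law_u_orthogonal[OF \<pi>] plm_law_u_orthogonal[OF \<mu>]
      plm_law_eps_orthogonal by simp
  finally show ?thesis .
qed

end

lemma plm_law_unique:
  fixes P :: "('d::finite) obs measure"
  assumes 1: "plm_law \<beta>1 v1 \<mu>1 \<pi>1 P" "\<mu>1 \<in> T_class" "\<pi>1 \<in> T_class"
    and 2: "plm_law \<beta>2 v2 \<mu>2 \<pi>2 P" "\<mu>2 \<in> T_class" "\<pi>2 \<in> T_class"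
  shows "\<beta>1 = \<beta>2"
proof -
  let ?d = "\<lambda>\<omega>::'d obs. \<pi>1 (fst \<omega>) - \<pi>2 (fst \<omega>)"
  note orth = plm_law_u_orthogonal[OF 1 1(3)] plm_law_u_orthogonal[OF 1 2(3)]
    plm_law_u_orthogonal[OF 2 1(3)] plm_law_u_orthogonal[OF 2 2(3)]
  have eq: "(\<lambda>\<omega>. (?d \<omega>)\<^sup>2) = (\<lambda>\<omega>.
      (\<pi>1 (fst \<omega>) * (fst (snd \<omega>) - \<pi>2 (fst \<omega>)) - \<pi>2 (fst \<omega>) * (fst (snd \<omega>) - \<pi>2 (fst \<omega>))) -
      (\<pi>1 (fst \<omega>) * (fst (snd \<omega>) - \<pi>1 (fst \<omega>)) - \<pi>2 (fst \<omega>) * (fst (snd \<omega>) - \<pi>1 (fst \<omega>))))"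
    by (auto simp: fun_eq_iff algebra_simps power2_eq_square)
  have int: "integrable P (\<lambda>\<omega>. (?d \<omega>)\<^sup>2)" and zero: "(\<integral>\<omega>. (?d \<omega>)\<^sup>2 \<partial>P) = 0"
    unfolding eq using orth by simp_all
  have "AE \<omega> in P. (?d \<omega>)\<^sup>2 = 0"
    using integral_nonneg_eq_0_iff_AE[OF int] zero by simp
  then have ae: "AE \<omega> in P. \<pi>1 (fst \<omega>) = \<pi>2 (fst \<omega>)"
    by simp
  note meas = plm_law_u_measurable[OF 1] plm_law_u_measurable[OF 2] plm_law_measurable(3)[OF 1]
  have "(\<integral>\<omega>. (fst (snd \<omega>) - \<pi>1 (fst \<omega>))\<^sup>2 \<partial>P) = (\<integral>\<omega>. (fst (snd \<omega>) - \<pi>2 (fst \<omega>))\<^sup>2 \<partial>P)"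
    by (rule integral_cong_AE) (use meas ae in auto)
  then have v: "v1 = v2"
    using plm_law_u_square(2)[OF 1] plm_law_u_square(2)[OF 2] by simp
  have "(\<integral>\<omega>. (fst (snd \<omega>) - \<pi>1 (fst \<omega>)) * snd (snd \<omega>) \<partial>P) =
      (\<integral>\<omega>. (fst (snd \<omega>) - \<pi>2 (fst \<omega>)) * snd (snd \<omega>) \<partial>P)"
    by (rule integral_cong_AE) (use meas ae in auto)
  then have "\<beta>1 * v1 = \<beta>2 * v2"
    using plm_law_cov[OF 1] plm_law_cov[OF 2] by simp
  moreover have "v2 > 0" using 2(1) by (simp add: plm_law_def)
  ultimately show ?thesis using v by simp
qed

lemma theta_eq:
  assumes "plm_law \<beta> v \<mu> \<pi> P" "\<mu> \<in> T_class" "\<pi> \<in> T_class"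
  shows "theta P = \<beta>"
  unfolding theta_def
proof (rule the_equality)
  fix \<beta>' assume "\<exists>v \<mu> \<pi>. \<mu> \<in> T_class \<and> \<pi> \<in> T_class \<and> plm_law \<beta>' v \<mu> \<pi> P"
  then show "\<beta>' = \<beta>" using plm_law_unique assms by blast
qed (use assms in blast)

end

theory Submission
  imports Defs
begin

text \<open>The right-hand side is a sum of three terms, and each of them is a lower bound for the risk up
  to a constant (\<open>1/8\<close>, \<open>1/16\<close> and \<open>1/64\<close>), so that the sum is at most
  \<open>8 + 16 + 64 = 88\<close> times the risk. All three bounds come from one construction.

  Let \<open>T\<close> and \<open>Y\<close> be signs. Under the null law they are fair and independent of each other and of
  \<open>X\<close>, and \<open>\<beta> = 0\<close>. For a function \<open>\<xi>\<close> with values in \<open>{-1, 1}\<close> the alternative has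
  \<open>E[T | X] = a \<xi>(X)\<close> and \<open>E[Y | T, X] = \<beta> T + h \<xi>(X)\<close>, so that \<open>\<pi> = a \<xi>\<close> and
  \<open>\<mu> = h \<xi>\<close>. Relative to the null law its density is \<open>1 + a t \<xi> + (\<beta> + a h) t y + (h + a \<beta>) y \<xi>\<close>.
  If \<open>\<beta> = - a h\<close>, the term \<open>t y\<close> vanishes: the pair \<open>(T, Y)\<close> carries no information on \<open>\<beta>\<close>
  unless \<open>\<xi>\<close> is known. If moreover \<open>\<xi>\<close> is drawn at random from a family of nearly
  uncorrelated functions, then the mixture of the alternatives has a second moment of at most \<open>2\<close>
  relative to the null law, and no estimator separates \<open>\<beta> = - a h\<close> from \<open>\<beta> = 0\<close>
  (\<open>mixture_two_point_bound\<close>).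

  The family has to be rich and yet consist of \<open>s\<close>-sparse combinations of \<open>m\<close> orthonormal functions. Cut
  the cube into \<open>s\<close> blocks of equal mass, let \<open>\<xi>\<close> be on block \<open>b\<close> the \<open>J(b)\<close>-th of many
  independent fair coins, and take the normalised restrictions of coins to blocks as the basis. Two random
  selections \<open>J\<close> and \<open>K\<close> from \<open>M\<close> coins agree on a block with probability \<open>1/M\<close>, and the
  correlation of their sign functions is the share of blocks on which they agree; this makes the second moment
  small as long as \<open>s exp(N \<kappa> / s)\<close> is at most of the order of \<open>M\<close>, where \<open>N\<close> is the sample
  size and \<open>\<kappa> = a\<^sup>2 + (h + a \<beta>)\<^sup>2\<close> (\<open>block_sign_overlap_sum\<close>). The three terms are the following cases.
  \<^item> \<open>n powr (-1/2)\<close>: here \<open>a = h = 0\<close>, which is the parametric two-point problem.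
  \<^item> \<open>\<delta>\<close>: here \<open>a\<close> is constant and \<open>h\<close> is proportional to \<open>\<delta>\<close>. The ball around \<open>0\<close> contains
    every \<open>h \<xi>\<close>, so \<open>M\<close> may be as large as desired.
  \<^item> \<open>s log(m/s) / n\<close>: here \<open>h \<xi>\<close> has to be a sparse combination, so \<open>M = m div s\<close>, and
    \<open>a = h\<close> with \<open>a\<^sup>2\<close> of the order of \<open>s log(m/s) / n\<close>. The condition \<open>m \<ge> n ^ 3\<close>
    ensures that \<open>m/s\<close> dominates the number \<open>s\<close> of blocks.\<close>

section \<open>The uniform law on the cube\<close>

lemma sets_nu [simp, measurable_cong]: "sets (nu :: (real ^ 'd::finite) measure) = sets borel"
  by (simp add: nu_def)

lemma space_nu [simp]: "space (nu :: (real ^ 'd::finite) measure) = UNIV"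
  by (simp add: nu_def)

lemma unit_cube_eq_cbox: "{x :: real ^ 'd::finite. \<forall>i. 0 \<le> x $ i \<and> x $ i \<le> 1} = cbox 0 1"
  by (auto simp: mem_box_cart)

lemma measure_unit_cube: "emeasure lborel (cbox (0 :: real ^ 'd::finite) 1) = 1"
  by (subst emeasure_lborel_cbox_eq)
    (auto simp: Basis_vec_def inner_axis intro!: prod.neutral)

lemma prob_space_nu: "prob_space (nu :: (real ^ 'd::finite) measure)"
  unfolding nu_def unit_cube_eq_cbox
  by (rule prob_space_uniform_measure) (simp_all add: measure_unit_cube)

lemma nu_slab_le:
  fixes a b :: real and i :: "'d::finite"
  assumes "a \<le> b"
  shows "measure (nu :: (real ^ 'd::finite) measure) {x. a \<le> x $ i \<and> x $ i \<le> b} \<le> b - a"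
proof -
  let ?C = "cbox (0 :: real ^ 'd::finite) 1"
  let ?l = "\<chi> j. if j = i then a else 0" and ?u = "\<chi> j. if j = i then b else 1"
  have sub: "?C \<inter> {x. a \<le> x $ i \<and> x $ i \<le> b} \<subseteq> cbox ?l ?u"
    by (auto simp: mem_box_cart)
  have B: "(Basis :: (real ^ 'd) set) = range (\<lambda>j. axis j 1)"
    by (auto simp: Basis_vec_def)
  have inj: "inj (\<lambda>j. axis j 1 :: real ^ 'd)"
    by (auto simp: inj_on_def axis_eq_axis)
  have "measure lborel (cbox ?l ?u) = (\<Prod>j\<in>UNIV. (?u - ?l) $ j)"
    using assms by (simp add: measure_lborel_cbox_eq B prod.reindex[OF inj] inner_axis)
  also have "\<dots> = b - a"
    by (subst prod.remove[of _ i]) auto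
  finally have box: "measure lborel (cbox ?l ?u) = b - a" .
  have "measure lborel (?C \<inter> {x. a \<le> x $ i \<and> x $ i \<le> b}) \<le> measure lborel (cbox ?l ?u)"
    by (rule measure_mono_fmeasurable[OF sub]) (auto intro!: fmeasurable_cbox)
  moreover have "measure (nu :: (real ^ 'd::finite) measure) {x. a \<le> x $ i \<and> x $ i \<le> b}
      = measure lborel (?C \<inter> {x. a \<le> x $ i \<and> x $ i \<le> b})"
    unfolding nu_def unit_cube_eq_cbox
    by (subst measure_uniform_measure) (simp_all add: measure_unit_cube measure_def)
  ultimately show ?thesis using box by simp
qed

text \<open>A cell is a slab in one coordinate direction. The measurability of \<open>c\<close> into the counting space lets
  arbitrary functions of the cell index serve as random variables.\<close>

lemma nu_equipartition:
  assumes "K > 0"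
  obtains c :: "real ^ 'd::finite \<Rightarrow> nat"
  where "c \<in> borel \<rightarrow>\<^sub>M count_space UNIV" "\<And>x. c x < K"
    "\<And>k. k < K \<Longrightarrow> measure nu {x. c x = k} = 1 / real K"
proof
  fix i :: 'd
  interpret nu: prob_space "nu :: (real ^ 'd::finite) measure" by (rule prob_space_nu)
  let ?c = "\<lambda>x :: real ^ 'd. min (K - 1) (nat \<lfloor>real K * x $ i\<rfloor>)"
  show meas [measurable]: "?c \<in> borel \<rightarrow>\<^sub>M count_space UNIV" by measurable
  show lt: "\<And>x. ?c x < K" using assms by auto
  have set_meas [measurable]: "{x. ?c x = k} \<in> sets borel" for k by measurable
  have cube: "AE x in (nu :: (real ^ 'd::finite) measure). x \<in> cbox 0 1"
    unfolding nu_def unit_cube_eq_cbox by (rule AE_uniform_measureI) auto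
  have le: "measure nu {x. ?c x = k} \<le> 1 / real K" if "k < K" for k
  proof -
    let ?S = "{x :: real ^ 'd. real k / real K \<le> x $ i \<and> x $ i \<le> (real k + 1) / real K}"
    have "measure nu {x. ?c x = k} \<le> measure nu ?S"
    proof (rule nu.finite_measure_mono_AE)
      show "AE x in nu. x \<in> {x. ?c x = k} \<longrightarrow> x \<in> ?S"
        using cube
      proof eventually_elim
        case (elim x)
        show ?case
        proof
          assume "x \<in> {x. ?c x = k}"
          then have eq: "min (K - 1) (nat \<lfloor>real K * x $ i\<rfloor>) = k" by simp
          have x: "0 \<le> x $ i" "x $ i \<le> 1" using elim by (auto simp: mem_box_cart)
          have nonneg: "0 \<le> real K * x $ i" using x by simp
          have "k \<le> nat \<lfloor>real K * x $ i\<rfloor>" using eq by linarith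
          then have lo: "real k \<le> real K * x $ i" using nonneg by linarith
          have hi: "real K * x $ i \<le> real k + 1"
          proof (cases "nat \<lfloor>real K * x $ i\<rfloor> \<le> K - 1")
            case True
            then have "nat \<lfloor>real K * x $ i\<rfloor> = k" using eq by simp
            then show ?thesis using nonneg by linarith
          next
            case False
            then have "k = K - 1" using eq by simp
            moreover have "real K * x $ i \<le> real K * 1" by (rule mult_left_mono) (use x in auto)
            ultimately show ?thesis using assms by (simp add: of_nat_diff)
          qed
          show "x \<in> ?S" using lo hi assms by (simp add: field_simps)
        qed
      qed
    qed measurable
    also have "\<dots> \<le> (real k + 1) / real K - real k / real K"
      by (rule nu_slab_le) (use assms in \<open>simp add: divide_right_mono\<close>)
    also have "\<dots> = 1 / real K" by (simp add: diff_divide_distrib[symmetric])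
    finally show ?thesis .
  qed
  \<comment> \<open>The \<open>K\<close> masses sum to one and none exceeds \<open>1 / K\<close>, so the cell boundaries need no treatment.\<close>
  have "(\<Sum>k<K. measure nu {x. ?c x = k}) = measure nu (\<Union>k<K. {x. ?c x = k})"
    by (rule nu.finite_measure_finite_Union[symmetric]) (auto simp: disjoint_family_on_def)
  also have "(\<Union>k<K. {x. ?c x = k}) = space nu" using lt by auto
  finally have total: "(\<Sum>k<K. measure nu {x. ?c x = k}) = 1" by (simp add: nu.prob_space del: space_nu)
  fix k assume k: "k < K"
  have "(\<Sum>k<K. 1 / real K - measure nu {x. ?c x = k}) = 0"
    using total assms by (simp add: sum_subtractf)
  then have "1 / real K - measure nu {x. ?c x = k} = 0"
    using le k by (subst (asm) sum_nonneg_eq_0_iff) auto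
  then show "measure nu {x. ?c x = k} = 1 / real K" by simp
qed

text \<open>Every finite uniform experiment is a function of \<open>X\<close>. This reduces all integrals over the cube
  that occur below to finite averages.\<close>

lemma nu_simulates_uniform:
  assumes "finite S" "S \<noteq> {}"
  obtains c :: "real ^ 'd::finite \<Rightarrow> 'k"
  where "c \<in> borel \<rightarrow>\<^sub>M count_space UNIV" "\<And>x. c x \<in> S"
    "\<And>f :: 'k \<Rightarrow> real. (\<integral>x. f (c x) \<partial>nu) = (\<Sum>k\<in>S. f k) / card S"
proof -
  interpret nu: prob_space "nu :: (real ^ 'd::finite) measure" by (rule prob_space_nu)
  have K: "card S > 0" using assms by (simp add: card_gt_0_iff)
  obtain c :: "real ^ 'd \<Rightarrow> nat" where c [measurable]: "c \<in> borel \<rightarrow>\<^sub>M count_space UNIV"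
    and lt: "\<And>x. c x < card S"
    and m: "\<And>k. k < card S \<Longrightarrow> measure nu {x. c x = k} = 1 / real (card S)"
    using nu_equipartition[OF K] by blast
  obtain e where e: "bij_betw e {0..<card S} S"
    using ex_bij_betw_nat_finite[OF assms(1)] by blast
  have [measurable]: "{x. c x = k} \<in> sets borel" for k by measurable
  have int: "(\<integral>x. f (e (c x)) \<partial>nu) = (\<Sum>k\<in>S. f k) / card S" for f :: "'k \<Rightarrow> real"
  proof -
    have "(\<integral>x. f (e (c x)) \<partial>nu) = (\<integral>x. (\<Sum>k<card S. f (e k) * indicator {x. c x = k} x) \<partial>nu)"
    proof (rule Bochner_Integration.integral_cong[OF refl])
      fix x
      have "(\<Sum>k<card S. f (e k) * indicator {x. c x = k} x) = (\<Sum>k<card S. if c x = k then f (e k) else 0)"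
        by (rule sum.cong) (auto simp: indicator_def)
      then show "f (e (c x)) = (\<Sum>k<card S. f (e k) * indicator {x. c x = k} x)"
        using lt[of x] by simp
    qed
    also have "\<dots> = (\<Sum>k<card S. f (e k) * measure nu {x. c x = k})"
      by (subst Bochner_Integration.integral_sum) (simp_all add: nu.emeasure_eq_measure)
    also have "\<dots> = (\<Sum>k<card S. f (e k) * (1 / card S))"
      by (rule sum.cong) (simp_all add: m)
    also have "\<dots> = (\<Sum>k\<in>{0..<card S}. f (e k)) / card S"
      by (simp add: sum_divide_distrib atLeast0LessThan)
    also have "(\<Sum>k\<in>{0..<card S}. f (e k)) = (\<Sum>k\<in>S. f k)"
      by (rule sum.reindex_bij_betw[OF e])
    finally show ?thesis .
  qed
  show thesis
  proof (rule that[of "\<lambda>x. e (c x)", OF _ _ int])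
    show "(\<lambda>x. e (c x)) \<in> borel \<rightarrow>\<^sub>M count_space UNIV" by measurable
    show "e (c x) \<in> S" for x
      using lt[of x] e by (auto simp: bij_betw_def)
  qed
qed

section \<open>Laws with binary treatment and outcome\<close>

definition sign_pairs :: "(real \<times> real) measure" where
  "sign_pairs = distr (measure_pmf (pmf_of_set ({-1, 1} \<times> {-1, 1}))) borel (\<lambda>z. z)"

definition null_law :: "('d::finite) obs measure" where
  "null_law = nu \<Otimes>\<^sub>M sign_pairs"

text \<open>Likelihood ratios are polynomials in the signs \<open>t\<close> and \<open>y\<close>. Composing with \<open>sg\<close> extends them
  from \<open>{-1, 1}\<close> to the line in such a way that they stay bounded and nonnegative.\<close>

definition sg :: "real \<Rightarrow> real" where
  "sg t = (if 0 \<le> t then 1 else -1)"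

lemma sg_simps [simp]: "sg 1 = 1" "sg (-1) = -1"
  by (simp_all add: sg_def)

lemma sg_cases: "sg t = 1 \<or> sg t = -1"
  by (simp add: sg_def)

lemma measurable_sg [measurable]: "sg \<in> borel_measurable borel"
  unfolding sg_def by measurable

lemma sets_sign_pairs [simp, measurable_cong]: "sets sign_pairs = sets borel"
  by (simp add: sign_pairs_def)

lemma prob_space_sign_pairs: "prob_space sign_pairs"
  unfolding sign_pairs_def by (rule prob_space.prob_space_distr[OF prob_space_measure_pmf]) simp

lemma nn_integral_sign_pairs:
  assumes "f \<in> borel_measurable borel"
  shows "(\<integral>\<^sup>+z. f z \<partial>sign_pairs) = (f (1, 1) + f (1, -1) + f (-1, 1) + f (-1, -1)) / 4"
proof -
  have "(\<integral>\<^sup>+z. f z \<partial>sign_pairs) =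
      (\<integral>\<^sup>+z. f z \<partial>measure_pmf (pmf_of_set ({-1, 1} \<times> {-1, 1})))"
    unfolding sign_pairs_def by (rule nn_integral_distr) (use assms in auto)
  also have "\<dots> = (\<Sum>z\<in>{-1, 1} \<times> {-1, 1}. f z) / 4"
    by (subst nn_integral_pmf_of_set) auto
  also have "(\<Sum>z\<in>{-1, 1} \<times> {-1, 1}. f z) = f (1, 1) + f (1, -1) + f (-1, 1) + f (-1, -1)"
    by (simp add: sum.cartesian_product[symmetric] ac_simps)
  finally show ?thesis .
qed

lemma integral_sign_pairs:
  fixes f :: "real \<times> real \<Rightarrow> real"
  assumes "f \<in> borel_measurable borel"
  shows "(\<integral>z. f z \<partial>sign_pairs) = (f (1, 1) + f (1, -1) + f (-1, 1) + f (-1, -1)) / 4"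
proof -
  have "(\<integral>z. f z \<partial>sign_pairs) = (\<integral>z. f z \<partial>measure_pmf (pmf_of_set ({-1, 1} \<times> {-1, 1})))"
    unfolding sign_pairs_def by (rule integral_distr) (use assms in auto)
  also have "\<dots> = (\<Sum>z\<in>{-1, 1} \<times> {-1, 1}. f z) / 4"
    by (subst integral_pmf_of_set) auto
  also have "(\<Sum>z\<in>{-1, 1} \<times> {-1, 1}. f z) = f (1, 1) + f (1, -1) + f (-1, 1) + f (-1, -1)"
    by (simp add: sum.cartesian_product[symmetric] ac_simps)
  finally show ?thesis .
qed

lemma borel_obs: "(borel :: ('d::finite) obs measure) = borel \<Otimes>\<^sub>M (borel \<Otimes>\<^sub>M borel)"
  by (simp add: borel_prod)

lemma sets_null_law [simp, measurable_cong]: "sets (null_law :: ('d::finite) obs measure) = sets borel"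
proof -
  have "sets (null_law :: 'd obs measure) = sets (borel \<Otimes>\<^sub>M borel)"
    unfolding null_law_def by (rule sets_pair_measure_cong) simp_all
  then show ?thesis by (simp only: borel_prod)
qed

lemma space_null_law [simp]: "space (null_law :: ('d::finite) obs measure) = UNIV"
  using sets_eq_imp_space_eq[OF sets_null_law] by simp

lemma pair_prob_space_nu_sign_pairs:
  "pair_prob_space (nu :: (real ^ 'd::finite) measure) sign_pairs"
  unfolding pair_prob_space_def pair_sigma_finite_def
  using prob_space_nu prob_space_sign_pairs by (auto intro: prob_space_imp_sigma_finite)

lemma prob_space_null_law: "prob_space (null_law :: ('d::finite) obs measure)"
proof -
  interpret pair_prob_space "nu :: (real ^ 'd) measure" sign_pairs
    by (rule pair_prob_space_nu_sign_pairs)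
  show ?thesis unfolding null_law_def by (rule P.prob_space_axioms)
qed

lemma measurable_obs_section:
  assumes "f \<in> borel_measurable (borel :: ('d::finite) obs measure)"
  shows "(\<lambda>z. f (x, z)) \<in> borel_measurable borel"
    and "(\<lambda>x. f (x, t, y)) \<in> borel_measurable borel"
proof -
  have "(\<lambda>z :: real \<times> real. (x, z)) \<in> borel \<rightarrow>\<^sub>M (borel :: 'd obs measure)"
    unfolding borel_prod[symmetric] by measurable
  then show "(\<lambda>z. f (x, z)) \<in> borel_measurable borel"
    by (rule measurable_compose[OF _ assms])
  have "(\<lambda>x :: real ^ 'd. (x, t, y)) \<in> borel \<rightarrow>\<^sub>M (borel :: 'd obs measure)"
    unfolding borel_prod[symmetric] by measurable
  then show "(\<lambda>x. f (x, t, y)) \<in> borel_measurable borel"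
    by (rule measurable_compose[OF _ assms])
qed

lemma AE_null_law_signs:
  "AE (x, t, y) in (null_law :: ('d::finite) obs measure). (t = 1 \<or> t = -1) \<and> (y = 1 \<or> y = -1)"
proof -
  interpret pair_prob_space "nu :: (real ^ 'd) measure" sign_pairs
    by (rule pair_prob_space_nu_sign_pairs)
  let ?N = "{z :: 'd obs. \<not> ((fst (snd z) = 1 \<or> fst (snd z) = -1) \<and>
    (snd (snd z) = 1 \<or> snd (snd z) = -1))}"
  have "Measurable.pred (borel \<Otimes>\<^sub>M (borel \<Otimes>\<^sub>M borel)) (\<lambda>z :: 'd obs.
      \<not> ((fst (snd z) = 1 \<or> fst (snd z) = -1) \<and> (snd (snd z) = 1 \<or> snd (snd z) = -1)))"
    by measurable
  then have meas: "?N \<in> sets borel"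
    by (simp add: pred_def space_pair_measure borel_obs)
  have "emeasure null_law ?N = (\<integral>\<^sup>+z. indicator ?N z \<partial>(nu \<Otimes>\<^sub>M sign_pairs))"
    unfolding null_law_def[symmetric] using meas by simp
  also have "\<dots> = (\<integral>\<^sup>+x. \<integral>\<^sup>+z. indicator ?N (x, z) \<partial>sign_pairs \<partial>nu)"
    by (rule M2.nn_integral_fst[symmetric], fold null_law_def)
      (rule borel_measurable_indicator, use meas in simp)
  also have "\<dots> = 0"
    using meas by (simp add: nn_integral_sign_pairs)
  finally show ?thesis
    using meas by (intro AE_I[of _ _ ?N]) auto
qed

lemma null_law_integral:
  fixes f :: "('d::finite) obs \<Rightarrow> real"
  assumes f [measurable]: "f \<in> borel_measurable borel"
    and bd: "\<And>x t y. t \<in> {-1, 1} \<Longrightarrow> y \<in> {-1, 1} \<Longrightarrow> \<bar>f (x, t, y)\<bar> \<le> B"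
  shows "integrable null_law f"
    and "(\<integral>z. f z \<partial>null_law) =
      (\<integral>x. (f (x, 1, 1) + f (x, 1, -1) + f (x, -1, 1) + f (x, -1, -1)) / 4 \<partial>nu)"
proof -
  interpret pair_prob_space "nu :: (real ^ 'd) measure" sign_pairs
    by (rule pair_prob_space_nu_sign_pairs)
  interpret N: prob_space "null_law :: 'd obs measure" by (rule prob_space_null_law)
  show int: "integrable null_law f"
  proof (rule N.integrable_const_bound[where B=B])
    show "AE z in null_law. norm (f z) \<le> B"
      using AE_null_law_signs by eventually_elim (use bd in auto)
  qed simp
  have "(\<integral>z. f z \<partial>null_law) = (\<integral>x. \<integral>z. f (x, z) \<partial>sign_pairs \<partial>nu)"
    unfolding null_law_def by (rule integral_fst'[symmetric]) (use int in \<open>simp add: null_law_def\<close>)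
  also have "\<dots> = (\<integral>x. (f (x, 1, 1) + f (x, 1, -1) + f (x, -1, 1) + f (x, -1, -1)) / 4 \<partial>nu)"
    by (rule Bochner_Integration.integral_cong) (simp_all add: integral_sign_pairs measurable_obs_section)
  finally show "(\<integral>z. f z \<partial>null_law) =
      (\<integral>x. (f (x, 1, 1) + f (x, 1, -1) + f (x, -1, 1) + f (x, -1, -1)) / 4 \<partial>nu)" .
qed

text \<open>Under the tilted law \<open>T\<close> is \<open>t\<close> with conditional probability \<open>(1 + a t \<xi>(X)) / 2\<close>, and \<open>Y\<close> is
  \<open>y\<close> with conditional probability \<open>(1 + y (\<beta> T + h \<xi>(X))) / 2\<close>; the law of \<open>X\<close> is unchanged.\<close>

definition tilt :: "real \<Rightarrow> real \<Rightarrow> real \<Rightarrow> (real ^ 'd \<Rightarrow> real) \<Rightarrow> ('d::finite) obs \<Rightarrow> real" where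
  "tilt a h \<beta> \<xi> = (\<lambda>(x, t, y). (1 + a * sg t * \<xi> x) * (1 + sg y * (\<beta> * sg t + h * \<xi> x)))"

definition tilted_law :: "real \<Rightarrow> real \<Rightarrow> real \<Rightarrow> (real ^ 'd \<Rightarrow> real) \<Rightarrow> ('d::finite) obs measure" where
  "tilted_law a h \<beta> \<xi> = density null_law (\<lambda>z. ennreal (tilt a h \<beta> \<xi> z))"

lemma measurable_tilt [measurable]:
  assumes [measurable]: "\<xi> \<in> borel_measurable borel"
  shows "tilt a h \<beta> \<xi> \<in> borel_measurable borel"
  unfolding tilt_def borel_obs by measurable

text \<open>All conditional moments in \<open>plm_law\<close> are constants, so they can be identified by testing the
  centred variable against the sets of the conditioning \<open>\<sigma>\<close>-algebra.\<close>

lemma real_cond_exp_eq_constI: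
  assumes "prob_space P" "subalgebra P F" "integrable P f"
    and eq: "\<And>A. A \<in> sets F \<Longrightarrow> (\<integral>z. indicator A z * (f z - c) \<partial>P) = 0"
  shows "AE z in P. real_cond_exp P F f z = c"
proof -
  interpret prob_space P by fact
  interpret sigma_finite_subalgebra P F
    using finite_measure_axioms assms(2)
    by (auto intro!: finite_measure_subalgebra_is_sigma_finite
        simp: finite_measure_subalgebra_def finite_measure_subalgebra_axioms_def)
  show ?thesis
  proof (rule real_cond_exp_charact)
    fix A assume A: "A \<in> sets F"
    then have AP: "A \<in> sets P" using assms(2) by (auto simp: subalgebra_def)
    have int: "integrable P (\<lambda>z. indicator A z * f z)" "integrable P (\<lambda>z. indicator A z * c)"
      using integrable_mult_indicator[OF AP assms(3)] AP
      by (auto simp: emeasure_eq_measure)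
    have "(\<integral>z. indicator A z * f z \<partial>P) - (\<integral>z. indicator A z * c \<partial>P) =
        (\<integral>z. indicator A z * (f z - c) \<partial>P)"
      using int by (simp add: right_diff_distrib Bochner_Integration.integral_diff)
    then show "(\<integral>z\<in>A. f z \<partial>P) = (\<integral>z\<in>A. c \<partial>P)"
      using eq[OF A] by (simp add: set_lebesgue_integral_def)
  qed (use assms in auto)
qed

text \<open>The first bound keeps the conditional probabilities of \<open>Y\<close> nonnegative, the second one those of \<open>T\<close>,
  and it makes the treatment variance \<open>v = 1 - a\<^sup>2\<close> at least \<open>1/3\<close>.\<close>

locale binary_model =
  fixes a h \<beta> :: real and \<xi> :: "real ^ 'd::finite \<Rightarrow> real"
  assumes \<xi> [measurable]: "\<xi> \<in> borel_measurable borel"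
    and \<xi>_sign: "\<And>x. \<xi> x = 1 \<or> \<xi> x = -1"
    and bound: "\<bar>\<beta>\<bar> + \<bar>h\<bar> \<le> 1"
    and a: "a\<^sup>2 \<le> 2 / 3"
begin

lemma a_le_1: "\<bar>a\<bar> \<le> 1"
proof -
  have "\<bar>a\<bar>\<^sup>2 \<le> 1\<^sup>2" using a by simp
  then show ?thesis by (simp only: abs_square_le_1 power_one power2_abs)
qed

lemma tilt_bounds: "0 \<le> tilt a h \<beta> \<xi> z" "tilt a h \<beta> \<xi> z \<le> 4"
proof -
  obtain x t y where z: "z = (x, t, y)" by (cases z)
  have 1: "0 \<le> 1 + a * sg t * \<xi> x" "1 + a * sg t * \<xi> x \<le> 2"
    using a_le_1 sg_cases[of t] \<xi>_sign[of x] by auto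
  have 2: "0 \<le> 1 + sg y * (\<beta> * sg t + h * \<xi> x)" "1 + sg y * (\<beta> * sg t + h * \<xi> x) \<le> 2"
    using bound sg_cases[of t] sg_cases[of y] \<xi>_sign[of x] by auto
  show "0 \<le> tilt a h \<beta> \<xi> z" unfolding z tilt_def using 1 2 by simp
  show "tilt a h \<beta> \<xi> z \<le> 4" unfolding z tilt_def using mult_mono[OF 1(2) 2(2)] 1 2 by simp
qed

text \<open>Integration over the two signs is an explicit average with four terms. Every property of the tilted
  law below follows from this formula by algebra in the integrand.\<close>

lemma tilted_law_integral:
  fixes f :: "'d obs \<Rightarrow> real"
  assumes f [measurable]: "f \<in> borel_measurable borel"
    and bd: "\<And>x t y. t \<in> {-1, 1} \<Longrightarrow> y \<in> {-1, 1} \<Longrightarrow> \<bar>f (x, t, y)\<bar> \<le> B"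
  shows "integrable (tilted_law a h \<beta> \<xi>) f"
    and "(\<integral>z. f z \<partial>tilted_law a h \<beta> \<xi>) =
      (\<integral>x. ((1 + a * \<xi> x) * ((1 + (\<beta> + h * \<xi> x)) * f (x, 1, 1) + (1 - (\<beta> + h * \<xi> x)) * f (x, 1, -1)) +
            (1 - a * \<xi> x) * ((1 + (h * \<xi> x - \<beta>)) * f (x, -1, 1) + (1 - (h * \<xi> x - \<beta>)) * f (x, -1, -1))) / 4 \<partial>nu)"
proof -
  have bd': "\<bar>tilt a h \<beta> \<xi> (x, t, y) * f (x, t, y)\<bar> \<le> 4 * B" if "t \<in> {-1, 1}" "y \<in> {-1, 1}" for x t y
    unfolding abs_mult by (rule mult_mono) (use tilt_bounds[of "(x, t, y)"] bd[OF that] in auto)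
  have meas: "(\<lambda>z. tilt a h \<beta> \<xi> z * f z) \<in> borel_measurable borel" by simp
  note int = null_law_integral[OF meas bd']
  show "integrable (tilted_law a h \<beta> \<xi>) f"
    unfolding tilted_law_def using int(1) tilt_bounds(1) by (subst integrable_density) simp_all
  have "(\<integral>z. f z \<partial>tilted_law a h \<beta> \<xi>) = (\<integral>z. tilt a h \<beta> \<xi> z * f z \<partial>null_law)"
    unfolding tilted_law_def using tilt_bounds(1) by (subst integral_density) simp_all
  also have "\<dots> = (\<integral>x. ((1 + a * \<xi> x) * ((1 + (\<beta> + h * \<xi> x)) * f (x, 1, 1) + (1 - (\<beta> + h * \<xi> x)) * f (x, 1, -1)) +
            (1 - a * \<xi> x) * ((1 + (h * \<xi> x - \<beta>)) * f (x, -1, 1) + (1 - (h * \<xi> x - \<beta>)) * f (x, -1, -1))) / 4 \<partial>nu)"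
    by (subst int(2)) (auto simp: tilt_def algebra_simps intro!: Bochner_Integration.integral_cong)
  finally show "(\<integral>z. f z \<partial>tilted_law a h \<beta> \<xi>) =
      (\<integral>x. ((1 + a * \<xi> x) * ((1 + (\<beta> + h * \<xi> x)) * f (x, 1, 1) + (1 - (\<beta> + h * \<xi> x)) * f (x, 1, -1)) +
            (1 - a * \<xi> x) * ((1 + (h * \<xi> x - \<beta>)) * f (x, -1, 1) + (1 - (h * \<xi> x - \<beta>)) * f (x, -1, -1))) / 4 \<partial>nu)" .
qed

lemma tilt_integrable: "integrable null_law (tilt a h \<beta> \<xi>)"
  and tilt_integral: "(\<integral>z. tilt a h \<beta> \<xi> z \<partial>null_law) = 1"
proof -
  interpret nu: prob_space "nu :: (real ^ 'd) measure" by (rule prob_space_nu)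
  note * = null_law_integral[where f="tilt a h \<beta> \<xi>" and B=4]
  show "integrable null_law (tilt a h \<beta> \<xi>)"
    by (rule *(1)) (use tilt_bounds in \<open>auto simp: abs_of_nonneg\<close>)
  have "(\<integral>z. tilt a h \<beta> \<xi> z \<partial>null_law) =
      (\<integral>x. (tilt a h \<beta> \<xi> (x, 1, 1) + tilt a h \<beta> \<xi> (x, 1, -1) + tilt a h \<beta> \<xi> (x, -1, 1) +
        tilt a h \<beta> \<xi> (x, -1, -1)) / 4 \<partial>nu)"
    by (rule *(2)) (use tilt_bounds in \<open>auto simp: abs_of_nonneg\<close>)
  also have "\<dots> = (\<integral>x. 1 \<partial>(nu :: (real ^ 'd) measure))"
    by (rule Bochner_Integration.integral_cong) (simp_all add: tilt_def algebra_simps)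
  finally have "(\<integral>z. tilt a h \<beta> \<xi> z \<partial>null_law) = (\<integral>x. 1 \<partial>(nu :: (real ^ 'd) measure))" .
  then show "(\<integral>z. tilt a h \<beta> \<xi> z \<partial>null_law) = 1" using nu.prob_space by simp
qed

lemma sets_tilted_law [simp, measurable_cong]: "sets (tilted_law a h \<beta> \<xi>) = sets borel"
  by (simp add: tilted_law_def)

lemma space_tilted_law [simp]: "space (tilted_law a h \<beta> \<xi>) = UNIV"
  by (simp add: tilted_law_def)

lemma prob_space_tilted_law: "prob_space (tilted_law a h \<beta> \<xi>)"
proof
  have "emeasure (tilted_law a h \<beta> \<xi>) (space (tilted_law a h \<beta> \<xi>)) =
      (\<integral>\<^sup>+z. ennreal (tilt a h \<beta> \<xi> z) \<partial>null_law)"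
    by (simp add: tilted_law_def emeasure_density)
  also have "\<dots> = ennreal (\<integral>z. tilt a h \<beta> \<xi> z \<partial>null_law)"
    by (rule nn_integral_eq_integral[OF tilt_integrable]) (simp add: tilt_bounds)
  also have "\<dots> = 1" by (simp add: tilt_integral)
  finally show "emeasure (tilted_law a h \<beta> \<xi>) (space (tilted_law a h \<beta> \<xi>)) = 1" .
qed

lemma AE_tilted_law_signs:
  "AE (x, t, y) in tilted_law a h \<beta> \<xi>. (t = 1 \<or> t = -1) \<and> (y = 1 \<or> y = -1)"
  unfolding tilted_law_def by (subst AE_density) (use AE_null_law_signs in \<open>auto elim!: AE_mp\<close>)

lemma distr_tilted_law_X: "distr (tilted_law a h \<beta> \<xi>) borel (\<lambda>(x, t, y). x) = nu"
proof (rule measure_eqI)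
  interpret nu: prob_space "nu :: (real ^ 'd) measure" by (rule prob_space_nu)
  interpret P: prob_space "tilted_law a h \<beta> \<xi>" by (rule prob_space_tilted_law)
  have X [measurable]: "(\<lambda>(x, t, y). x) \<in> borel_measurable (borel :: 'd obs measure)"
    unfolding borel_obs by measurable
  fix A assume "A \<in> sets (distr (tilted_law a h \<beta> \<xi>) borel (\<lambda>(x, t, y). x))"
  then have A [measurable]: "A \<in> sets borel" by simp
  let ?f = "\<lambda>(x, t, y). indicator A x :: real"
  have f: "?f \<in> borel_measurable (borel :: 'd obs measure)"
    unfolding borel_obs by measurable
  have B: "(\<lambda>(x, t, y). x) -` A \<in> sets (borel :: 'd obs measure)"
    using measurable_sets[OF X A] by simp
  have "P.prob ((\<lambda>(x, t, y). x) -` A) = (\<integral>z. indicator ((\<lambda>(x, t, y). x) -` A) z \<partial>tilted_law a h \<beta> \<xi>)"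
    using B by simp
  also have "\<dots> = (\<integral>z. ?f z \<partial>tilted_law a h \<beta> \<xi>)"
    by (rule Bochner_Integration.integral_cong) (auto simp: indicator_def)
  also have "\<dots> = (\<integral>x. indicator A x \<partial>nu)"
    by (subst tilted_law_integral(2)[OF f, of 1])
      (auto simp: algebra_simps intro!: Bochner_Integration.integral_cong)
  finally have "P.prob ((\<lambda>(x, t, y). x) -` A) = nu.prob A" by simp
  then show "emeasure (distr (tilted_law a h \<beta> \<xi>) borel (\<lambda>(x, t, y). x)) A = emeasure nu A"
    using B by (simp add: emeasure_distr P.emeasure_eq_measure nu.emeasure_eq_measure)
qed simp

lemma tilted_law_subalgebra:
  "subalgebra (tilted_law a h \<beta> \<xi>) (sigma_X (tilted_law a h \<beta> \<xi>))"
  "subalgebra (tilted_law a h \<beta> \<xi>) (sigma_XT (tilted_law a h \<beta> \<xi>))"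
proof -
  have X: "(\<lambda>(x, t, y). x) \<in> tilted_law a h \<beta> \<xi> \<rightarrow>\<^sub>M borel"
    unfolding measurable_cong_sets[OF sets_tilted_law refl] borel_obs by measurable
  show "subalgebra (tilted_law a h \<beta> \<xi>) (sigma_X (tilted_law a h \<beta> \<xi>))"
    using sets_image_in_sets[OF refl X] by (simp add: subalgebra_def sigma_X_def)
  have XT: "(\<lambda>(x, t, y). (x, t)) \<in> tilted_law a h \<beta> \<xi> \<rightarrow>\<^sub>M borel"
    unfolding measurable_cong_sets[OF sets_tilted_law refl] borel_prod[symmetric] by measurable
  show "subalgebra (tilted_law a h \<beta> \<xi>) (sigma_XT (tilted_law a h \<beta> \<xi>))"
    using sets_image_in_sets[OF refl XT] by (simp add: subalgebra_def sigma_XT_def)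
qed

lemma abs_\<xi>: "\<bar>\<xi> x\<bar> = 1" and \<xi>_square: "\<xi> x * \<xi> x = 1"
  using \<xi>_sign[of x] by auto

lemma treatment_cond_exp:
  "AE \<omega> in tilted_law a h \<beta> \<xi>. real_cond_exp (tilted_law a h \<beta> \<xi>) (sigma_X (tilted_law a h \<beta> \<xi>))
     (\<lambda>(x, t, y). t - a * \<xi> x) \<omega> = 0" (is ?mean)
  "AE \<omega> in tilted_law a h \<beta> \<xi>. real_cond_exp (tilted_law a h \<beta> \<xi>) (sigma_X (tilted_law a h \<beta> \<xi>))
     (\<lambda>(x, t, y). (t - a * \<xi> x)\<^sup>2) \<omega> = 1 - a\<^sup>2" (is ?var)
proof -
  have a\<xi>: "\<bar>a * \<xi> x\<bar> \<le> 1" for x using a_le_1 by (simp add: abs_mult abs_\<xi>)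
  have u_bd: "\<bar>t - a * \<xi> x\<bar> \<le> 2" if "t \<in> {-1, 1}" for t x
    using a\<xi>[of x] that by auto
  have u2_bd: "\<bar>(t - a * \<xi> x)\<^sup>2\<bar> \<le> 4" if "t \<in> {-1, 1}" for t x
    using power_mono[OF u_bd[OF that, of x], of 2] by (simp add: power2_eq_square abs_mult)
  have meas: "(\<lambda>(x, t, y). t - a * \<xi> x) \<in> borel_measurable (borel :: 'd obs measure)"
    "(\<lambda>(x, t, y). (t - a * \<xi> x)\<^sup>2) \<in> borel_measurable (borel :: 'd obs measure)"
    unfolding borel_obs by measurable
  have A_form: "\<exists>B \<in> sets borel. A = {(x, t, y). x \<in> B}"
    if "A \<in> sets (sigma_X (tilted_law a h \<beta> \<xi>))" for A
    using that unfolding sigma_X_def by (subst (asm) sets_vimage_algebra2) auto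
  show ?mean
  proof (rule real_cond_exp_eq_constI[OF prob_space_tilted_law tilted_law_subalgebra(1)])
    show "integrable (tilted_law a h \<beta> \<xi>) (\<lambda>(x, t, y). t - a * \<xi> x)"
      by (rule tilted_law_integral(1)[OF meas(1), of 2]) (use u_bd in auto)
    fix A assume "A \<in> sets (sigma_X (tilted_law a h \<beta> \<xi>))"
    from A_form[OF this] obtain B where B [measurable]: "B \<in> sets borel" and A: "A = {(x, t, y). x \<in> B}"
      by blast
    let ?f = "\<lambda>z. indicator A z * ((case z of (x, t, y) \<Rightarrow> t - a * \<xi> x) - 0)"
    have "?f = (\<lambda>(x, t, y). indicator B x * (t - a * \<xi> x))"
      by (auto simp: fun_eq_iff A indicator_def)
    then have "?f \<in> borel_measurable borel" unfolding borel_obs by simp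
    then show "(\<integral>z. ?f z \<partial>tilted_law a h \<beta> \<xi>) = 0"
      by (subst tilted_law_integral(2)[of _ 2])
        (use u_bd in \<open>auto simp: A indicator_def algebra_simps\<close>)
  qed
  show ?var
  proof (rule real_cond_exp_eq_constI[OF prob_space_tilted_law tilted_law_subalgebra(1)])
    show "integrable (tilted_law a h \<beta> \<xi>) (\<lambda>(x, t, y). (t - a * \<xi> x)\<^sup>2)"
      by (rule tilted_law_integral(1)[OF meas(2), of 4]) (use u2_bd in auto)
    fix A assume "A \<in> sets (sigma_X (tilted_law a h \<beta> \<xi>))"
    from A_form[OF this] obtain B where B [measurable]: "B \<in> sets borel" and A: "A = {(x, t, y). x \<in> B}"
      by blast
    let ?f = "\<lambda>z. indicator A z * ((case z of (x, t, y) \<Rightarrow> (t - a * \<xi> x)\<^sup>2) - (1 - a\<^sup>2))"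
    have "?f = (\<lambda>(x, t, y). indicator B x * ((t - a * \<xi> x)\<^sup>2 - (1 - a\<^sup>2)))"
      by (auto simp: fun_eq_iff A indicator_def)
    then have f: "?f \<in> borel_measurable borel" unfolding borel_obs by simp
    have bd: "\<bar>?f (x, t, y)\<bar> \<le> 5" if "t \<in> {-1, 1}" for x t y
    proof -
      have "\<bar>(t - a * \<xi> x)\<^sup>2 - (1 - a\<^sup>2)\<bar> \<le> 5"
        using u2_bd[OF that, of x] a zero_le_power2[of a] by linarith
      then show ?thesis by (simp add: indicator_def)
    qed
    have "(\<integral>z. ?f z \<partial>tilted_law a h \<beta> \<xi>) = (\<integral>x. 0 \<partial>(nu :: (real ^ 'd) measure))"
    proof (subst tilted_law_integral(2)[OF f, of 5], goal_cases)
      case (1 x t y)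
      then show ?case using bd by simp
    next
      case 2
      show ?case
      proof (rule Bochner_Integration.integral_cong[OF refl], goal_cases)
        case (1 x)
        show ?case
          using \<xi>_sign[of x] by (auto simp: A indicator_def algebra_simps power2_eq_square)
      qed
    qed
    then show "(\<integral>z. ?f z \<partial>tilted_law a h \<beta> \<xi>) = 0" by simp
  qed
qed

text \<open>For fixed \<open>x\<close> and \<open>t\<close> the two values of \<open>y\<close> have the weights \<open>(1 \<pm> q) / 2\<close> with
  \<open>q = \<beta> t + h \<xi>(x)\<close>, and the deviations \<open>\<pm> 1 - q\<close> cancel against them.\<close>

lemma outcome_cond_exp:
  "AE \<omega> in tilted_law a h \<beta> \<xi>. real_cond_exp (tilted_law a h \<beta> \<xi>) (sigma_XT (tilted_law a h \<beta> \<xi>))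
     (\<lambda>(x, t, y). y - t * \<beta> - h * \<xi> x) \<omega> = 0"
proof (rule real_cond_exp_eq_constI[OF prob_space_tilted_law tilted_law_subalgebra(2)])
  have eps_bd: "\<bar>y - t * \<beta> - h * \<xi> x\<bar> \<le> 2" if "t \<in> {-1, 1}" "y \<in> {-1, 1}" for t y x
    using \<xi>_sign[of x] bound that by auto
  have meas: "(\<lambda>(x, t, y). y - t * \<beta> - h * \<xi> x) \<in> borel_measurable (borel :: 'd obs measure)"
    unfolding borel_obs by measurable
  show "integrable (tilted_law a h \<beta> \<xi>) (\<lambda>(x, t, y). y - t * \<beta> - h * \<xi> x)"
    by (rule tilted_law_integral(1)[OF meas, of 2]) (use eps_bd in auto)
  fix A assume "A \<in> sets (sigma_XT (tilted_law a h \<beta> \<xi>))"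
  then have "\<exists>B \<in> sets (borel :: ((real ^ 'd) \<times> real) measure). A = {(x, t, y). (x, t) \<in> B}"
    unfolding sigma_XT_def by (subst (asm) sets_vimage_algebra2) auto
  then obtain B where B: "B \<in> sets (borel :: ((real ^ 'd) \<times> real) measure)"
    and A: "A = {(x, t, y). (x, t) \<in> B}"
    by blast
  let ?f = "\<lambda>z. indicator A z * ((case z of (x, t, y) \<Rightarrow> y - t * \<beta> - h * \<xi> x) - 0)"
  have [measurable]: "B \<in> sets (borel \<Otimes>\<^sub>M borel)" using B by (simp only: borel_prod)
  have "?f = (\<lambda>(x, t, y). indicator B (x, t) * (y - t * \<beta> - h * \<xi> x))"
    by (auto simp: fun_eq_iff A indicator_def)
  then have f: "?f \<in> borel_measurable borel" unfolding borel_obs by simp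
  have bd: "\<bar>?f (x, t, y)\<bar> \<le> 2" if "t \<in> {-1, 1}" "y \<in> {-1, 1}" for x t y
    using eps_bd[OF that, of x] by (auto simp: indicator_def)
  have "(\<integral>z. ?f z \<partial>tilted_law a h \<beta> \<xi>) = (\<integral>x. 0 \<partial>(nu :: (real ^ 'd) measure))"
    by (subst tilted_law_integral(2)[OF f, of 2])
      (use bd in \<open>auto simp: A indicator_def algebra_simps intro!: Bochner_Integration.integral_cong\<close>)
  then show "(\<integral>z. ?f z \<partial>tilted_law a h \<beta> \<xi>) = 0" by simp
qed

lemma plm_law_tilted_law: "plm_law \<beta> (1 - a\<^sup>2) (\<lambda>x. h * \<xi> x) (\<lambda>x. a * \<xi> x) (tilted_law a h \<beta> \<xi>)"
proof -
  have "AE (x, t, y) in tilted_law a h \<beta> \<xi>. max \<bar>t\<bar> \<bar>y\<bar> \<le> 3"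
    using AE_tilted_law_signs by eventually_elim auto
  moreover have "max \<bar>\<beta>\<bar> \<bar>1 - a\<^sup>2\<bar> \<le> 3" "1 - a\<^sup>2 \<ge> 1 / 3"
    using a bound zero_le_power2[of a] by linarith+
  ultimately show ?thesis
    unfolding plm_law_def
    by (intro conjI prob_space_tilted_law distr_tilted_law_X treatment_cond_exp outcome_cond_exp
        sets_tilted_law)
qed

lemma sign_multiple_in_T_class:
  assumes "\<bar>r\<bar> \<le> 3"
  shows "(\<lambda>x. r * \<xi> x) \<in> T_class"
proof -
  interpret nu: prob_space "nu :: (real ^ 'd) measure" by (rule prob_space_nu)
  have "(\<lambda>x. (r * \<xi> x)\<^sup>2) = (\<lambda>x. r\<^sup>2)"
    using \<xi>_square by (simp add: power2_eq_square mult_ac fun_eq_iff)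
  then have "integrable nu (\<lambda>x. (r * \<xi> x)\<^sup>2)" by simp
  moreover have "esssup nu (\<lambda>x. ereal \<bar>r * \<xi> x\<bar>) \<le> 3"
    by (rule esssup_I) (use assms in \<open>auto simp: abs_mult abs_\<xi>\<close>)
  ultimately show ?thesis by (simp add: T_class_def L2_space_def)
qed

lemma tilted_law_in_P_class:
  assumes "(\<lambda>x. h * \<xi> x) \<in> F"
  shows "tilted_law a h \<beta> \<xi> \<in> P_class F"
  unfolding P_class_def
  using plm_law_tilted_law assms sign_multiple_in_T_class[of a] a_le_1 by fastforce

lemma theta_tilted_law: "theta (tilted_law a h \<beta> \<xi>) = \<beta>"
  by (rule theta_eq[OF plm_law_tilted_law]) (use sign_multiple_in_T_class a_le_1 bound in auto)

end

text \<open>Expanding the product, a tilt is \<open>1 + a \<xi> t + (\<beta> + a h) t y + (h + a \<beta>) \<xi> y\<close>, and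
  \<open>1\<close>, \<open>t\<close>, \<open>y\<close>, \<open>t y\<close> are orthonormal under the fair signs. The coefficient of \<open>t y\<close> is the
  only one that is common to all sign functions, and it vanishes for \<open>\<beta> = - a h\<close>; the others enter
  through the correlation of \<open>\<xi>\<close> and \<open>\<eta>\<close>.\<close>

lemma tilt_inner_product:
  fixes \<xi> \<eta> :: "real ^ 'd::finite \<Rightarrow> real"
  assumes "binary_model a h \<beta> \<xi>" "binary_model a h \<beta> \<eta>"
  shows "integrable null_law (\<lambda>z. tilt a h \<beta> \<xi> z * tilt a h \<beta> \<eta> z)"
    and "(\<integral>z. tilt a h \<beta> \<xi> z * tilt a h \<beta> \<eta> z \<partial>null_law) =
    1 + (\<beta> + a * h)\<^sup>2 + (a\<^sup>2 + (h + a * \<beta>)\<^sup>2) * (\<integral>x. \<xi> x * \<eta> x \<partial>nu)"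
proof -
  interpret nu: prob_space "nu :: (real ^ 'd) measure" by (rule prob_space_nu)
  interpret X: binary_model a h \<beta> \<xi> by fact
  interpret Y: binary_model a h \<beta> \<eta> by fact
  have bd: "\<bar>tilt a h \<beta> \<xi> z * tilt a h \<beta> \<eta> z\<bar> \<le> 4 * 4" for z
    unfolding abs_mult by (rule mult_mono) (use X.tilt_bounds[of z] Y.tilt_bounds[of z] in auto)
  note * = null_law_integral[where f="\<lambda>z. tilt a h \<beta> \<xi> z * tilt a h \<beta> \<eta> z" and B="4 * 4", OF _ bd]
  show "integrable null_law (\<lambda>z. tilt a h \<beta> \<xi> z * tilt a h \<beta> \<eta> z)"
    by (rule *(1)) simp
  have int: "integrable (nu :: (real ^ 'd) measure) (\<lambda>x. \<xi> x * \<eta> x)"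
    by (rule nu.integrable_const_bound[where B=1]) (simp_all add: abs_mult X.abs_\<xi> Y.abs_\<xi>)
  have "(\<integral>z. tilt a h \<beta> \<xi> z * tilt a h \<beta> \<eta> z \<partial>null_law) =
      (\<integral>x. 1 + (\<beta> + a * h)\<^sup>2 + (a\<^sup>2 + (h + a * \<beta>)\<^sup>2) * (\<xi> x * \<eta> x) \<partial>nu)"
  proof (subst *(2), simp, rule Bochner_Integration.integral_cong[OF refl], goal_cases)
    case (1 x)
    show ?case
      using X.\<xi>_sign[of x] Y.\<xi>_sign[of x]
      by (elim disjE) (simp_all add: tilt_def field_simps power2_eq_square)
  qed
  also have "\<dots> = 1 + (\<beta> + a * h)\<^sup>2 + (a\<^sup>2 + (h + a * \<beta>)\<^sup>2) * (\<integral>x. \<xi> x * \<eta> x \<partial>nu)"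
    using int nu.prob_space by simp
  finally show "(\<integral>z. tilt a h \<beta> \<xi> z * tilt a h \<beta> \<eta> z \<partial>null_law) =
    1 + (\<beta> + a * h)\<^sup>2 + (a\<^sup>2 + (h + a * \<beta>)\<^sup>2) * (\<integral>x. \<xi> x * \<eta> x \<partial>nu)" .
qed

section \<open>A two-point bound against a mixture\<close>

lemma ennreal_integral_le_nn_integral:
  fixes f :: "'a \<Rightarrow> real"
  assumes "integrable M f"
  shows "ennreal (\<integral>x. f x \<partial>M) \<le> (\<integral>\<^sup>+x. ennreal (f x) \<partial>M)"
proof -
  have int: "integrable M (\<lambda>x. max 0 (f x))" using assms by simp
  have "ennreal (\<integral>x. f x \<partial>M) \<le> ennreal (\<integral>x. max 0 (f x) \<partial>M)"
    by (intro ennreal_leI integral_mono assms int) simp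
  also have "\<dots> = (\<integral>\<^sup>+x. ennreal (max 0 (f x)) \<partial>M)"
    by (rule nn_integral_eq_integral[OF int, symmetric]) simp
  also have "\<dots> = (\<integral>\<^sup>+x. ennreal (f x) \<partial>M)"
    by (rule nn_integral_cong) (simp add: max_def ennreal_neg)
  finally show ?thesis .
qed

lemma PiM_density:
  assumes "finite I" "sigma_finite_measure M" "sigma_finite_measure (density M f)"
    and [measurable]: "f \<in> borel_measurable M"
  shows "Pi\<^sub>M I (\<lambda>_. density M f) = density (Pi\<^sub>M I (\<lambda>_. M)) (\<lambda>\<omega>. \<Prod>i\<in>I. f (\<omega> i))"
proof -
  interpret M: product_sigma_finite "\<lambda>_. M" using assms(2) by (simp add: product_sigma_finite_def)
  interpret D: product_sigma_finite "\<lambda>_. density M f" using assms(3) by (simp add: product_sigma_finite_def)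
  have meas [measurable]: "(\<lambda>\<omega>. \<Prod>i\<in>I. f (\<omega> i)) \<in> borel_measurable (Pi\<^sub>M I (\<lambda>_. M))"
    by measurable
  have "density (Pi\<^sub>M I (\<lambda>_. M)) (\<lambda>\<omega>. \<Prod>i\<in>I. f (\<omega> i)) = Pi\<^sub>M I (\<lambda>_. density M f)"
  proof (rule D.PiM_eqI[OF assms(1)])
    show "sets (density (Pi\<^sub>M I (\<lambda>_. M)) (\<lambda>\<omega>. \<Prod>i\<in>I. f (\<omega> i))) = sets (Pi\<^sub>M I (\<lambda>_. density M f))"
      by (simp, rule sets_PiM_cong) simp_all
    fix A assume "\<And>i. i \<in> I \<Longrightarrow> A i \<in> sets (density M f)"
    then have A [measurable]: "A i \<in> sets M" if "i \<in> I" for i using that by simp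
    have E [measurable]: "Pi\<^sub>E I A \<in> sets (Pi\<^sub>M I (\<lambda>_. M))"
      by (rule sets_PiM_I_finite[OF assms(1)]) (use A in simp)
    have "emeasure (density (Pi\<^sub>M I (\<lambda>_. M)) (\<lambda>\<omega>. \<Prod>i\<in>I. f (\<omega> i))) (Pi\<^sub>E I A) =
        (\<integral>\<^sup>+\<omega>. (\<Prod>i\<in>I. f (\<omega> i)) * indicator (Pi\<^sub>E I A) \<omega> \<partial>Pi\<^sub>M I (\<lambda>_. M))"
      by (rule emeasure_density) simp_all
    also have "\<dots> = (\<integral>\<^sup>+\<omega>. (\<Prod>i\<in>I. f (\<omega> i) * indicator (A i) (\<omega> i)) \<partial>Pi\<^sub>M I (\<lambda>_. M))"
    proof (rule nn_integral_cong)
      fix \<omega> assume "\<omega> \<in> space (Pi\<^sub>M I (\<lambda>_. M))"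
      then have ext: "\<omega> \<in> extensional I" by (auto simp: space_PiM PiE_def)
      show "(\<Prod>i\<in>I. f (\<omega> i)) * indicator (Pi\<^sub>E I A) \<omega> = (\<Prod>i\<in>I. f (\<omega> i) * indicator (A i) (\<omega> i))"
      proof (cases "\<omega> \<in> Pi\<^sub>E I A")
        case True
        then have "(\<Prod>i\<in>I. f (\<omega> i) * indicator (A i) (\<omega> i)) = (\<Prod>i\<in>I. f (\<omega> i))"
          by (intro prod.cong) (auto simp: PiE_iff)
        then show ?thesis using True by simp
      next
        case False
        then obtain i where "i \<in> I" "\<omega> i \<notin> A i" using ext by (auto simp: PiE_iff)
        then have "(\<Prod>i\<in>I. f (\<omega> i) * indicator (A i) (\<omega> i)) = 0"
          using assms(1) by (intro prod_zero) (auto intro!: bexI[of _ i])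
        then show ?thesis using False by simp
      qed
    qed
    also have "\<dots> = (\<Prod>i\<in>I. \<integral>\<^sup>+x. f x * indicator (A i) x \<partial>M)"
      by (rule M.product_nn_integral_prod[OF assms(1)]) (use A in measurable)
    also have "\<dots> = (\<Prod>i\<in>I. emeasure (density M f) (A i))"
      by (rule prod.cong) (simp_all add: emeasure_density A)
    finally show "emeasure (density (Pi\<^sub>M I (\<lambda>_. M)) (\<lambda>\<omega>. \<Prod>i\<in>I. f (\<omega> i))) (Pi\<^sub>E I A) =
        (\<Prod>i\<in>I. emeasure (density M f) (A i))" .
  qed
  then show ?thesis by simp
qed

text \<open>An estimate \<open>e\<close> cannot be close to both \<open>b\<close> and \<open>b'\<close>, so the loss is at least
  \<open>min 1 l\<close> times their distance, and \<open>l - l\<^sup>2 / 4 \<le> min 1 l\<close>. The polynomial on the left turns into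
  the first two moments of the likelihood ratio \<open>l\<close> after integration, so that the total
  variation distance does not have to be introduced.\<close>

lemma two_point_loss_lower_bound:
  fixes l e b b' :: real
  assumes "0 \<le> l"
  shows "\<bar>b' - b\<bar> * (l - l\<^sup>2 / 4) \<le> \<bar>e - b\<bar> + l * \<bar>e - b'\<bar>"
proof -
  have q: "l - l\<^sup>2 / 4 \<le> 1" using zero_le_power2[of "l / 2 - 1"]
    by (simp add: power2_eq_square field_simps)
  have tri: "\<bar>b' - b\<bar> \<le> \<bar>e - b\<bar> + \<bar>e - b'\<bar>" by linarith
  have l: "l - l\<^sup>2 / 4 \<le> l" by simp
  have "\<bar>b' - b\<bar> * (l - l\<^sup>2 / 4) \<le> \<bar>b' - b\<bar> * min 1 l"
    using q l by (intro mult_left_mono) auto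
  also have "\<dots> \<le> (\<bar>e - b\<bar> + \<bar>e - b'\<bar>) * min 1 l"
    using tri assms by (intro mult_right_mono) auto
  also have "\<dots> \<le> \<bar>e - b\<bar> + l * \<bar>e - b'\<bar>"
    using mult_left_mono[of "min 1 l" 1 "\<bar>e - b\<bar>"] mult_left_mono[of "min 1 l" l "\<bar>e - b'\<bar>"]
    by (simp add: algebra_simps)
  finally show ?thesis .
qed

text \<open>The average risk over the alternatives is the risk under the mixture, whose likelihood ratio \<open>mix\<close> has
  mean \<open>1\<close>. The double sum in the hypothesis \<open>chi\<close> is the second moment of \<open>mix\<close> up to normalisation,
  because the integrals over independent observations factorise. By the pointwise bound above, twice the
  maximal risk is then at least \<open>\<bar>b' - b\<bar> (1 - 2 / 4)\<close>.\<close>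

lemma mixture_two_point_bound:
  fixes L :: "'j \<Rightarrow> 'a \<Rightarrow> real" and b b' :: real
  assumes M: "prob_space M" and J: "finite J" "J \<noteq> {}"
    and L: "\<And>j. j \<in> J \<Longrightarrow> integrable M (L j)" "\<And>j. j \<in> J \<Longrightarrow> (\<integral>z. L j z \<partial>M) = 1"
    and pos: "\<And>j z. j \<in> J \<Longrightarrow> 0 \<le> L j z"
    and LL: "\<And>j k. j \<in> J \<Longrightarrow> k \<in> J \<Longrightarrow> integrable M (\<lambda>z. L j z * L k z)"
    and chi: "(\<Sum>j\<in>J. \<Sum>k\<in>J. (\<integral>z. L j z * L k z \<partial>M) ^ N) \<le> 2 * (real (card J))\<^sup>2"
    and e [measurable]: "e \<in> borel_measurable (Pi\<^sub>M {..<N} (\<lambda>_. M))"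
    and risk: "(\<integral>\<^sup>+\<omega>. ennreal \<bar>e \<omega> - b\<bar> \<partial>Pi\<^sub>M {..<N} (\<lambda>_. M)) \<le> R"
    and risk': "\<And>j. j \<in> J \<Longrightarrow>
      (\<integral>\<^sup>+\<omega>. ennreal \<bar>e \<omega> - b'\<bar> \<partial>Pi\<^sub>M {..<N} (\<lambda>_. density M (\<lambda>z. ennreal (L j z)))) \<le> R"
  shows "ennreal (\<bar>b' - b\<bar> / 4) \<le> R"
proof -
  interpret M: prob_space M by fact
  interpret product_prob_space "\<lambda>_. M" "{..<N}"
    by unfold_locales
  define Q where "Q = Pi\<^sub>M {..<N} (\<lambda>_. M)"
  define W where "W = real (card J)"
  have W: "W > 0" using J by (simp add: W_def card_gt_0_iff)
  define l where "l j \<omega> = (\<Prod>i<N. L j (\<omega> i))" for j \<omega>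
  define mix where "mix \<omega> = (\<Sum>j\<in>J. l j \<omega>) / W" for \<omega>
  have l_int: "integrable Q (l j)" "(\<integral>\<omega>. l j \<omega> \<partial>Q) = 1" if "j \<in> J" for j
    using product_integrable_prod[of "{..<N}" "\<lambda>_. L j"] product_integral_prod[of "{..<N}" "\<lambda>_. L j"]
      L[OF that] by (simp_all add: Q_def l_def[abs_def])
  have ll: "l j \<omega> * l k \<omega> = (\<Prod>i<N. L j (\<omega> i) * L k (\<omega> i))" for j k \<omega>
    by (simp add: l_def prod.distrib)
  have ll_int: "integrable Q (\<lambda>\<omega>. l j \<omega> * l k \<omega>)"
      "(\<integral>\<omega>. l j \<omega> * l k \<omega> \<partial>Q) = (\<integral>z. L j z * L k z \<partial>M) ^ N" if "j \<in> J" "k \<in> J" for j k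
    using product_integrable_prod[of "{..<N}" "\<lambda>_ z. L j z * L k z"]
      product_integral_prod[of "{..<N}" "\<lambda>_ z. L j z * L k z"] LL[OF that]
    by (simp_all add: Q_def ll)
  have l_pos: "0 \<le> l j \<omega>" if "j \<in> J" for j \<omega>
    unfolding l_def by (rule prod_nonneg) (use pos[OF that] in auto)
  have mix_pos: "0 \<le> mix \<omega>" for \<omega>
    unfolding mix_def using W l_pos by (intro divide_nonneg_pos sum_nonneg) auto
  have mix_int: "integrable Q mix"
    unfolding mix_def[abs_def] using l_int(1) by simp
  have mix_integral: "(\<integral>\<omega>. mix \<omega> \<partial>Q) = 1"
    unfolding mix_def using l_int W by (simp add: W_def)
  have mix_sq: "(mix \<omega>)\<^sup>2 = (\<Sum>j\<in>J. \<Sum>k\<in>J. l j \<omega> * l k \<omega>) / W\<^sup>2" for \<omega>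
    unfolding mix_def by (simp add: power_divide power2_eq_square sum_product)
  have sq_int: "integrable Q (\<lambda>\<omega>. (mix \<omega>)\<^sup>2)"
    unfolding mix_sq using ll_int(1) by simp
  have "(\<integral>\<omega>. (mix \<omega>)\<^sup>2 \<partial>Q) = (\<Sum>j\<in>J. \<Sum>k\<in>J. (\<integral>z. L j z * L k z \<partial>M) ^ N) / W\<^sup>2"
    unfolding mix_sq using ll_int by simp
  also have "\<dots> \<le> 2"
    using chi W by (simp add: W_def divide_le_eq)
  finally have sq_le: "(\<integral>\<omega>. (mix \<omega>)\<^sup>2 \<partial>Q) \<le> 2" .
  have [measurable]: "e \<in> borel_measurable Q" by (simp add: Q_def)
  have [measurable]: "mix \<in> borel_measurable Q" using mix_int by simp
  have l_meas: "l j \<in> borel_measurable Q" if "j \<in> J" for j using l_int(1)[OF that] by simp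
  have mix_risk: "(\<integral>\<^sup>+\<omega>. ennreal (mix \<omega> * \<bar>e \<omega> - b'\<bar>) \<partial>Q) \<le> R"
  proof -
    have each: "(\<integral>\<^sup>+\<omega>. ennreal (l j \<omega> * \<bar>e \<omega> - b'\<bar>) \<partial>Q) \<le> R" if j: "j \<in> J" for j
    proof -
      have Lm [measurable]: "L j \<in> borel_measurable M" using L(1)[OF j] by simp
      have "emeasure (density M (\<lambda>z. ennreal (L j z))) (space M) = 1"
        using nn_integral_eq_integral[OF L(1)[OF j]] L(2)[OF j] pos[OF j]
        by (simp add: emeasure_density cong: nn_integral_cong)
      then have "prob_space (density M (\<lambda>z. ennreal (L j z)))"
        by (intro prob_spaceI) simp
      then have sf: "sigma_finite_measure (density M (\<lambda>z. ennreal (L j z)))"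
        by (rule prob_space_imp_sigma_finite)
      have P: "Pi\<^sub>M {..<N} (\<lambda>_. density M (\<lambda>z. ennreal (L j z))) = density Q (\<lambda>\<omega>. ennreal (l j \<omega>))"
        unfolding Q_def
        by (subst PiM_density[OF _ prob_space_imp_sigma_finite[OF M] sf])
          (auto simp: l_def prod_ennreal pos[OF j])
      have "(\<integral>\<^sup>+\<omega>. ennreal (l j \<omega> * \<bar>e \<omega> - b'\<bar>) \<partial>Q) =
          (\<integral>\<^sup>+\<omega>. ennreal \<bar>e \<omega> - b'\<bar> \<partial>density Q (\<lambda>\<omega>. ennreal (l j \<omega>)))"
        by (subst nn_integral_density) (auto simp: l_meas[OF j] ennreal_mult l_pos[OF j])
      then show ?thesis using risk'[OF j] by (simp add: P)
    qed
    have "(\<integral>\<^sup>+\<omega>. ennreal (mix \<omega> * \<bar>e \<omega> - b'\<bar>) \<partial>Q) =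
        (\<integral>\<^sup>+\<omega>. ennreal (1 / W) * (\<Sum>j\<in>J. ennreal (l j \<omega> * \<bar>e \<omega> - b'\<bar>)) \<partial>Q)"
    proof (rule nn_integral_cong)
      fix \<omega>
      have "mix \<omega> * \<bar>e \<omega> - b'\<bar> = 1 / W * (\<Sum>j\<in>J. l j \<omega> * \<bar>e \<omega> - b'\<bar>)"
        by (simp add: mix_def sum_distrib_right)
      then have "ennreal (mix \<omega> * \<bar>e \<omega> - b'\<bar>) = ennreal (1 / W) * ennreal (\<Sum>j\<in>J. l j \<omega> * \<bar>e \<omega> - b'\<bar>)"
        using W l_pos by (simp only: ) (rule ennreal_mult, auto intro!: sum_nonneg)
      also have "ennreal (\<Sum>j\<in>J. l j \<omega> * \<bar>e \<omega> - b'\<bar>) = (\<Sum>j\<in>J. ennreal (l j \<omega> * \<bar>e \<omega> - b'\<bar>))"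
        by (rule sum_ennreal[symmetric]) (simp add: l_pos)
      finally show "ennreal (mix \<omega> * \<bar>e \<omega> - b'\<bar>) =
        ennreal (1 / W) * (\<Sum>j\<in>J. ennreal (l j \<omega> * \<bar>e \<omega> - b'\<bar>))" .
    qed
    also have "\<dots> = ennreal (1 / W) * (\<Sum>j\<in>J. \<integral>\<^sup>+\<omega>. ennreal (l j \<omega> * \<bar>e \<omega> - b'\<bar>) \<partial>Q)"
      using l_meas by (subst nn_integral_cmult, simp, subst nn_integral_sum) simp_all
    also have "\<dots> \<le> ennreal (1 / W) * (\<Sum>j\<in>J. R)"
      by (intro mult_left_mono sum_mono each) simp_all
    also have "\<dots> = ennreal (1 / W) * ennreal W * R"
      by (simp add: W_def mult.assoc ennreal_of_nat_eq_real_of_nat)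
    also have "ennreal (1 / W) * ennreal W = 1"
      using W by (simp add: ennreal_mult[symmetric])
    finally show ?thesis by simp
  qed
  define f where "f \<omega> = \<bar>b' - b\<bar> * (mix \<omega> - (mix \<omega>)\<^sup>2 / 4)" for \<omega>
  have f_int: "integrable Q f"
    unfolding f_def[abs_def] using mix_int sq_int by simp
  have "\<bar>b' - b\<bar> / 2 \<le> \<bar>b' - b\<bar> * (1 - (\<integral>\<omega>. (mix \<omega>)\<^sup>2 \<partial>Q) / 4)"
    using mult_left_mono[of "1 / 2" "1 - (\<integral>\<omega>. (mix \<omega>)\<^sup>2 \<partial>Q) / 4" "\<bar>b' - b\<bar>"] sq_le by simp
  also have "\<dots> = (\<integral>\<omega>. f \<omega> \<partial>Q)"
    unfolding f_def using mix_int sq_int mix_integral by simp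
  finally have "ennreal (\<bar>b' - b\<bar> / 2) \<le> ennreal (\<integral>\<omega>. f \<omega> \<partial>Q)" by (rule ennreal_leI)
  also have "\<dots> \<le> (\<integral>\<^sup>+\<omega>. ennreal (f \<omega>) \<partial>Q)"
    by (rule ennreal_integral_le_nn_integral[OF f_int])
  also have "\<dots> \<le> (\<integral>\<^sup>+\<omega>. ennreal \<bar>e \<omega> - b\<bar> + ennreal (mix \<omega> * \<bar>e \<omega> - b'\<bar>) \<partial>Q)"
  proof (rule nn_integral_mono)
    fix \<omega>
    have "f \<omega> \<le> \<bar>e \<omega> - b\<bar> + mix \<omega> * \<bar>e \<omega> - b'\<bar>"
      unfolding f_def by (rule two_point_loss_lower_bound[OF mix_pos])
    then have "ennreal (f \<omega>) \<le> ennreal (\<bar>e \<omega> - b\<bar> + mix \<omega> * \<bar>e \<omega> - b'\<bar>)" by (rule ennreal_leI)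
    then show "ennreal (f \<omega>) \<le> ennreal \<bar>e \<omega> - b\<bar> + ennreal (mix \<omega> * \<bar>e \<omega> - b'\<bar>)"
      using mix_pos by (simp add: ennreal_plus)
  qed
  also have "\<dots> = (\<integral>\<^sup>+\<omega>. ennreal \<bar>e \<omega> - b\<bar> \<partial>Q) + (\<integral>\<^sup>+\<omega>. ennreal (mix \<omega> * \<bar>e \<omega> - b'\<bar>) \<partial>Q)"
    by (rule nn_integral_add) measurable
  also have "\<dots> \<le> R + R"
    using risk mix_risk by (intro add_mono) (simp_all add: Q_def)
  finally have le: "ennreal (\<bar>b' - b\<bar> / 2) \<le> R + R" .
  show ?thesis
  proof (cases R)
    case (real r)
    then have "\<bar>b' - b\<bar> / 2 \<le> r + r" using le by (simp add: ennreal_plus[symmetric] del: ennreal_plus)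
    then show ?thesis using real by (simp add: ennreal_leI)
  qed simp
qed

text \<open>The null law is the tilted law with all parameters zero, which is why \<open>F\<close> has to contain the zero
  function.\<close>

lemma minimax_risk_ge_of_binary_models:
  fixes \<xi> :: "'j \<Rightarrow> real ^ 'd::finite \<Rightarrow> real"
  assumes J: "finite J" "J \<noteq> {}"
    and model: "\<And>j. j \<in> J \<Longrightarrow> binary_model a h \<beta> (\<xi> j)"
    and F: "(\<lambda>_. 0) \<in> F" "\<And>j. j \<in> J \<Longrightarrow> (\<lambda>x. h * \<xi> j x) \<in> F"
    and chi: "(\<Sum>j\<in>J. \<Sum>k\<in>J. (1 + (\<beta> + a * h)\<^sup>2 +
      (a\<^sup>2 + (h + a * \<beta>)\<^sup>2) * (\<integral>x. \<xi> j x * \<xi> k x \<partial>nu)) ^ N) \<le> 2 * (real (card J))\<^sup>2"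
  shows "ennreal (\<bar>\<beta>\<bar> / 4) \<le> minimax_risk N (P_class F)"
  unfolding minimax_risk_def
proof (rule INF_greatest)
  fix e :: "(nat \<Rightarrow> 'd obs) \<Rightarrow> real" assume "e \<in> estimators N"
  then have e: "e \<in> borel_measurable (Pi\<^sub>M {..<N} (\<lambda>_. borel))" by (simp add: estimators_def)
  have "sets (Pi\<^sub>M {..<N} (\<lambda>_. null_law :: 'd obs measure)) = sets (Pi\<^sub>M {..<N} (\<lambda>_. borel))"
    by (rule sets_PiM_cong) simp_all
  then have e': "e \<in> borel_measurable (Pi\<^sub>M {..<N} (\<lambda>_. null_law))"
    using e by (simp cong: measurable_cong_sets)
  let ?R = "SUP P\<in>P_class F. \<integral>\<^sup>+ \<omega>. ennreal \<bar>e \<omega> - theta P\<bar> \<partial>Pi\<^sub>M {..<N} (\<lambda>_. P)"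
  interpret Z: binary_model 0 0 0 "\<lambda>_ :: real ^ 'd. 1" by unfold_locales auto
  have null: "tilted_law 0 0 0 (\<lambda>_ :: real ^ 'd. 1) = null_law"
    by (simp add: tilted_law_def tilt_def case_prod_beta' density_1)
  have "(\<integral>\<^sup>+\<omega>. ennreal \<bar>e \<omega> - 0\<bar> \<partial>Pi\<^sub>M {..<N} (\<lambda>_. null_law)) \<le> ?R"
    using Z.tilted_law_in_P_class[of F] Z.theta_tilted_law F(1)
    by (intro SUP_upper2[of null_law]) (simp_all add: null)
  moreover have "(\<integral>\<^sup>+\<omega>. ennreal \<bar>e \<omega> - \<beta>\<bar>
      \<partial>Pi\<^sub>M {..<N} (\<lambda>_. density null_law (\<lambda>z. ennreal (tilt a h \<beta> (\<xi> j) z)))) \<le> ?R"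
    if "j \<in> J" for j
  proof -
    interpret binary_model a h \<beta> "\<xi> j" by (rule model[OF that])
    show ?thesis
      unfolding tilted_law_def[symmetric]
      using tilted_law_in_P_class[OF F(2)[OF that]] theta_tilted_law
      by (intro SUP_upper2[of "tilted_law a h \<beta> (\<xi> j)"]) simp_all
  qed
  ultimately have "ennreal (\<bar>\<beta> - 0\<bar> / 4) \<le> ?R"
  proof (rule mixture_two_point_bound[OF prob_space_null_law J _ _ _ _ _ e', rotated -2])
    show "(\<Sum>j\<in>J. \<Sum>k\<in>J. (\<integral>z. tilt a h \<beta> (\<xi> j) z * tilt a h \<beta> (\<xi> k) z \<partial>null_law) ^ N)
        \<le> 2 * (real (card J))\<^sup>2"
      using chi by (simp add: tilt_inner_product(2)[OF model model] cong: sum.cong)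
  qed (use model in \<open>auto simp: binary_model.tilt_integrable binary_model.tilt_integral
      binary_model.tilt_bounds tilt_inner_product(1)\<close>)
  then show "ennreal (\<bar>\<beta>\<bar> / 4) \<le> ?R" by simp
qed

section \<open>Block signs and the orthonormal family\<close>

definition coin :: "nat \<Rightarrow> nat set \<Rightarrow> real" where
  "coin i A = (if i \<in> A then 1 else -1)"

lemma coin_cases: "coin i A = 1 \<or> coin i A = -1"
  by (simp add: coin_def)

lemma coin_mult_self [simp]: "coin i A * coin i A = 1"
  by (simp add: coin_def)

text \<open>The power set of \<open>{..<R}\<close> is the sample space of \<open>R\<close> fair coins. Flipping coin \<open>i\<close> changes the sign
  of the product of two different coins, so these are uncorrelated.\<close>

lemma sum_coin_mult_coin:
  assumes "i < R" "k < R"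
  shows "(\<Sum>A\<in>Pow {..<R}. coin i A * coin k A) = (if i = k then 2 ^ R else 0)"
proof (cases "i = k")
  case True
  then show ?thesis by (simp add: card_Pow)
next
  case False
  let ?flip = "\<lambda>A. if i \<in> A then A - {i} else insert i A"
  have "(\<Sum>A\<in>Pow {..<R}. coin i A * coin k A) = (\<Sum>A\<in>Pow {..<R}. - (coin i A * coin k A))"
    by (rule sum.reindex_bij_witness[of _ ?flip ?flip])
      (use assms False in \<open>auto simp: coin_def\<close>)
  then show ?thesis using False by (simp add: sum_negf)
qed

text \<open>The map \<open>c\<close> turns a uniform point \<open>X\<close> into a uniform block in \<open>{..<s}\<close> together with the outcome of
  \<open>R\<close> independent fair coins.\<close>

locale coin_cells =
  fixes s R :: nat and c :: "real ^ 'd::finite \<Rightarrow> nat \<times> nat set"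
  assumes s: "s > 0"
    and c_meas [measurable]: "c \<in> borel \<rightarrow>\<^sub>M count_space UNIV"
    and c_range: "\<And>x. c x \<in> {..<s} \<times> Pow {..<R}"
    and c_integral: "\<And>f :: nat \<times> nat set \<Rightarrow> real.
      (\<integral>x. f (c x) \<partial>nu) = (\<Sum>k\<in>{..<s} \<times> Pow {..<R}. f k) / card ({..<s} \<times> Pow {..<R})"
begin

lemma integral_cells:
  fixes f :: "nat \<Rightarrow> nat set \<Rightarrow> real"
  shows "(\<integral>x. f (fst (c x)) (snd (c x)) \<partial>nu) = (\<Sum>b<s. \<Sum>A\<in>Pow {..<R}. f b A) / (real s * 2 ^ R)"
  using c_integral[of "\<lambda>k. f (fst k) (snd k)"]
  by (simp add: sum.cartesian_product case_prod_beta' card_cartesian_product card_Pow)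

definition block_sign :: "(nat \<Rightarrow> nat) \<Rightarrow> real ^ 'd \<Rightarrow> real" where
  "block_sign J x = coin (J (fst (c x))) (snd (c x))"

text \<open>The index \<open>j \<in> {1..m}\<close> encodes the block \<open>(j - 1) mod s\<close> and the coin \<open>(j - 1) div s\<close>, so that
  each block receives at least \<open>m div s\<close> coins. The factor \<open>sqrt s\<close> compensates for the mass \<open>1 / s\<close> of a
  block.\<close>

definition block_basis :: "nat \<Rightarrow> real ^ 'd \<Rightarrow> real" where
  "block_basis j x =
     (if fst (c x) = (j - 1) mod s then sqrt s * coin ((j - 1) div s) (snd (c x)) else 0)"

lemma measurable_cells:
  fixes f :: "nat \<Rightarrow> nat set \<Rightarrow> real"
  shows "(\<lambda>x. f (fst (c x)) (snd (c x))) \<in> borel_measurable borel"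
  by (rule measurable_compose[OF c_meas]) simp

lemma block_sign_measurable [measurable]: "block_sign J \<in> borel_measurable borel"
  using measurable_cells[of "\<lambda>b A. coin (J b) A"] by (simp add: block_sign_def[abs_def])

lemma block_sign_cases: "block_sign J x = 1 \<or> block_sign J x = -1"
  unfolding block_sign_def by (rule coin_cases)

lemma block_basis_measurable [measurable]: "block_basis j \<in> borel_measurable borel"
  using measurable_cells[of "\<lambda>b A. if b = (j - 1) mod s then sqrt s * coin ((j - 1) div s) A else 0"]
  by (simp add: block_basis_def[abs_def])

text \<open>A block on which the selections differ contributes the correlation of two different coins, which is
  zero.\<close>

lemma block_sign_correlation:
  assumes "J \<in> {..<s} \<rightarrow> {..<R}" "K \<in> {..<s} \<rightarrow> {..<R}"
  shows "(\<integral>x. block_sign J x * block_sign K x \<partial>nu) = (\<Sum>b<s. of_bool (J b = K b)) / real s"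
proof -
  have "(\<integral>x. block_sign J x * block_sign K x \<partial>nu) =
      (\<Sum>b<s. \<Sum>A\<in>Pow {..<R}. coin (J b) A * coin (K b) A) / (real s * 2 ^ R)"
    unfolding block_sign_def by (rule integral_cells)
  also have "(\<Sum>b<s. \<Sum>A\<in>Pow {..<R}. coin (J b) A * coin (K b) A) =
      (\<Sum>b<s. 2 ^ R * of_bool (J b = K b))"
    by (intro sum.cong refl, subst sum_coin_mult_coin) (use assms in auto)
  also have "\<dots> / (real s * 2 ^ R) = (\<Sum>b<s. of_bool (J b = K b)) / real s"
    by (simp add: sum_distrib_left[symmetric])
  finally show ?thesis .
qed

lemma orthonormal_block_basis:
  assumes "m \<le> R"
  shows "orthonormal_basis_functions m block_basis"
  unfolding orthonormal_basis_functions_def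
proof (intro conjI ballI)
  interpret nu: prob_space "nu :: (real ^ 'd) measure" by (rule prob_space_nu)
  fix j assume "j \<in> {1..m}"
  have "integrable nu (\<lambda>x. (block_basis j x)\<^sup>2)"
  proof (rule nu.integrable_const_bound[where B="real s"])
    have "(block_basis j x)\<^sup>2 \<le> real s" for x
      using coin_cases[of "(j - 1) div s" "snd (c x)"]
      by (auto simp: block_basis_def power_mult_distrib)
    then show "AE x in nu. norm ((block_basis j x)\<^sup>2) \<le> real s" by simp
  qed simp
  then show "block_basis j \<in> L2_space nu" by (simp add: L2_space_def)
next
  fix i j assume ij: "i \<in> {1..m}" "j \<in> {1..m}"
  have lt: "(i - 1) div s < R" "(j - 1) div s < R"
    using ij assms by (auto intro!: le_less_trans[OF div_le_dividend])
  have "(\<integral>x. block_basis i x * block_basis j x \<partial>nu) = (\<Sum>b<s. \<Sum>A\<in>Pow {..<R}.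
      (if b = (i - 1) mod s then sqrt s * coin ((i - 1) div s) A else 0) *
      (if b = (j - 1) mod s then sqrt s * coin ((j - 1) div s) A else 0)) / (real s * 2 ^ R)"
    unfolding block_basis_def
    by (rule integral_cells[of "\<lambda>b A.
          (if b = (i - 1) mod s then sqrt s * coin ((i - 1) div s) A else 0) *
          (if b = (j - 1) mod s then sqrt s * coin ((j - 1) div s) A else 0)"])
  also have "(\<Sum>b<s. \<Sum>A\<in>Pow {..<R}.
      (if b = (i - 1) mod s then sqrt s * coin ((i - 1) div s) A else 0) *
      (if b = (j - 1) mod s then sqrt s * coin ((j - 1) div s) A else 0)) =
      (\<Sum>b<s. if b = (i - 1) mod s then
        (if (i - 1) mod s = (j - 1) mod s then
          real s * (\<Sum>A\<in>Pow {..<R}. coin ((i - 1) div s) A * coin ((j - 1) div s) A) else 0) else 0)"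
  proof (rule sum.cong[OF refl], goal_cases)
    case (1 b)
    have sq: "sqrt s * x * (sqrt s * y) = real s * (x * y)" for x y :: real
    proof -
      have "sqrt s * x * (sqrt s * y) = (sqrt s * sqrt s) * (x * y)" by (simp only: mult_ac)
      then show ?thesis by simp
    qed
    show ?case by (auto simp: sq sum_distrib_left)
  qed
  also have "\<dots> = (if (i - 1) mod s = (j - 1) mod s then
      real s * (\<Sum>A\<in>Pow {..<R}. coin ((i - 1) div s) A * coin ((j - 1) div s) A) else 0)"
    using s by simp
  also have "\<dots> = (if i = j then real s * 2 ^ R else 0)"
  proof -
    have "i = j" if "(i - 1) mod s = (j - 1) mod s" "(i - 1) div s = (j - 1) div s"
    proof -
      have "i - 1 = j - 1" using that by (metis div_mult_mod_eq)
      then show ?thesis using ij by auto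
    qed
    then have iff: "i = j \<longleftrightarrow> (i - 1) mod s = (j - 1) mod s \<and> (i - 1) div s = (j - 1) div s"
      by blast
    show ?thesis unfolding sum_coin_mult_coin[OF lt] iff by simp
  qed
  finally show "(\<integral>x. block_basis i x * block_basis j x \<partial>nu) = (if i = j then 1 else 0)"
    using s by (simp split: if_splits)
qed

text \<open>Bounding \<open>1 + x \<le> exp x\<close> makes each summand a product over the blocks, with the factor
  \<open>z = exp (N \<kappa> / s)\<close> where the selections agree. Summing over \<open>K\<close> is then done in each block
  separately: exactly one of the \<open>M\<close> choices agrees with \<open>J\<close>, hence the average is
  \<open>(1 + (z - 1) / M) ^ s\<close> for every \<open>J\<close>. The bound \<open>2\<close> stems from \<open>exp (1 / 2) \<le> 2\<close>.\<close>

lemma block_sign_overlap_sum: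
  assumes M: "0 < M" "M \<le> R" and \<kappa>: "0 \<le> \<kappa>\<^sub>0" "0 \<le> \<kappa>"
    and small: "real N * \<kappa>\<^sub>0 + real s * (exp (real N * \<kappa> / real s) - 1) / real M \<le> 1 / 2"
  defines "\<J> \<equiv> {..<s} \<rightarrow>\<^sub>E {..<M}"
  shows "(\<Sum>J\<in>\<J>. \<Sum>K\<in>\<J>. (1 + \<kappa>\<^sub>0 + \<kappa> * (\<integral>x. block_sign J x * block_sign K x \<partial>nu)) ^ N)
    \<le> 2 * (real (card \<J>))\<^sup>2"
proof -
  define z where "z = exp (real N * \<kappa> / real s)"
  have card: "real (card \<J>) = real M ^ s" by (simp add: \<J>_def card_PiE)
  have term_le: "(1 + \<kappa>\<^sub>0 + \<kappa> * (\<integral>x. block_sign J x * block_sign K x \<partial>nu)) ^ N \<le>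
      exp (real N * \<kappa>\<^sub>0) * (\<Prod>b<s. if J b = K b then z else 1)"
    if "J \<in> \<J>" "K \<in> \<J>" for J K
  proof -
    define \<rho> where "\<rho> = (\<Sum>b<s. of_bool (J b = K b)) / real s"
    have \<rho>: "(\<integral>x. block_sign J x * block_sign K x \<partial>nu) = \<rho>"
      unfolding \<rho>_def
    proof (rule block_sign_correlation)
      have "f b < R" if "f \<in> \<J>" "b < s" for f b
      proof -
        have "f b < M" using that by (auto simp: \<J>_def PiE_iff)
        then show ?thesis using M(2) by simp
      qed
      then show "J \<in> {..<s} \<rightarrow> {..<R}" "K \<in> {..<s} \<rightarrow> {..<R}"
        using \<open>J \<in> \<J>\<close> \<open>K \<in> \<J>\<close> by auto
    qed
    have "0 \<le> \<rho>" by (auto simp: \<rho>_def intro!: divide_nonneg_nonneg sum_nonneg)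
    then have "(1 + (\<kappa>\<^sub>0 + \<kappa> * \<rho>)) ^ N \<le> exp (\<kappa>\<^sub>0 + \<kappa> * \<rho>) ^ N"
      using \<kappa> by (intro power_mono exp_ge_add_one_self) (auto intro!: add_nonneg_nonneg)
    also have "\<dots> = exp (real N * \<kappa>\<^sub>0) * exp (\<Sum>b<s. real N * \<kappa> / real s * of_bool (J b = K b))"
    proof -
      have "(\<Sum>b<s. real N * \<kappa> / real s * of_bool (J b = K b)) = real N * (\<kappa> * \<rho>)"
        by (simp only: \<rho>_def sum_distrib_left[symmetric])
          (simp only: times_divide_eq_left times_divide_eq_right mult.assoc)
      then show ?thesis
        by (simp only: exp_of_nat_mult[symmetric] exp_add[symmetric] distrib_left)
    qed
    also have "exp (\<Sum>b<s. real N * \<kappa> / real s * of_bool (J b = K b)) =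
        (\<Prod>b<s. if J b = K b then z else 1)"
      unfolding z_def exp_sum[OF finite_lessThan] by (rule prod.cong) auto
    finally show ?thesis by (simp add: \<rho> add.assoc)
  qed
  have row: "(\<Sum>K\<in>\<J>. \<Prod>b<s. if J b = K b then z else 1) =
      real M ^ s * (1 + (z - 1) / real M) ^ s" if "J \<in> \<J>" for J
  proof -
    have "(\<Sum>K\<in>\<J>. \<Prod>b<s. if J b = K b then z else 1) = (\<Prod>b<s. \<Sum>i<M. if J b = i then z else 1)"
      unfolding \<J>_def by (rule prod_sum_PiE[symmetric]) auto
    also have "\<dots> = (\<Prod>b<s. real M * (1 + (z - 1) / real M))"
    proof (rule prod.cong[OF refl])
      fix b assume "b \<in> {..<s}"
      then have b: "J b < M" using that by (auto simp: \<J>_def PiE_iff)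
      have "(\<Sum>i<M. if J b = i then z else 1) = (\<Sum>i<M. 1 + (if J b = i then z - 1 else 0))"
        by (rule sum.cong) auto
      also have "\<dots> = real M + (z - 1)"
        using b by (simp add: sum.distrib)
      also have "\<dots> = real M * (1 + (z - 1) / real M)"
        using M by (simp add: field_simps)
      finally show "(\<Sum>i<M. if J b = i then z else 1) = real M * (1 + (z - 1) / real M)" .
    qed
    finally show ?thesis by (simp add: power_mult_distrib)
  qed
  have z1: "1 \<le> z" using \<kappa> by (simp add: z_def)
  have "(1 + (z - 1) / real M) ^ s \<le> exp ((z - 1) / real M) ^ s"
    using z1 by (intro power_mono exp_ge_add_one_self) (auto intro!: add_nonneg_nonneg)
  also have "\<dots> = exp (real s * (z - 1) / real M)"
    by (simp add: exp_of_nat_mult[symmetric])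
  finally have row_le: "(1 + (z - 1) / real M) ^ s \<le> exp (real s * (z - 1) / real M)" .
  have "(\<Sum>J\<in>\<J>. \<Sum>K\<in>\<J>. (1 + \<kappa>\<^sub>0 + \<kappa> * (\<integral>x. block_sign J x * block_sign K x \<partial>nu)) ^ N) \<le>
      (\<Sum>J\<in>\<J>. \<Sum>K\<in>\<J>. exp (real N * \<kappa>\<^sub>0) * (\<Prod>b<s. if J b = K b then z else 1))"
    by (intro sum_mono term_le)
  also have "\<dots> = (\<Sum>J\<in>\<J>. exp (real N * \<kappa>\<^sub>0) * (real M ^ s * (1 + (z - 1) / real M) ^ s))"
    by (intro sum.cong refl) (simp add: sum_distrib_left[symmetric] row)
  also have "\<dots> = (real M ^ s)\<^sup>2 * (exp (real N * \<kappa>\<^sub>0) * (1 + (z - 1) / real M) ^ s)"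
    by (simp add: card power2_eq_square)
  also have "\<dots> \<le> (real M ^ s)\<^sup>2 * (exp (real N * \<kappa>\<^sub>0) * exp (real s * (z - 1) / real M))"
    by (intro mult_left_mono row_le) auto
  also have "\<dots> \<le> (real M ^ s)\<^sup>2 * 2"
  proof (rule mult_left_mono)
    have "exp (real N * \<kappa>\<^sub>0) * exp (real s * (z - 1) / real M) \<le> exp (1 / 2)"
      using small by (simp add: exp_add[symmetric] z_def)
    also have "exp (1 / 2 :: real) \<le> 2" by (rule exp_half_le2)
    finally show "exp (real N * \<kappa>\<^sub>0) * exp (real s * (z - 1) / real M) \<le> 2" .
  qed simp
  finally show ?thesis by (simp add: card)
qed

lemma minimax_risk_ge_of_block_signs:
  assumes M: "0 < M" "M \<le> R" and bound: "\<bar>\<beta>\<bar> + \<bar>h\<bar> \<le> 1" and a: "a\<^sup>2 \<le> 2 / 3"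
    and F: "(\<lambda>_. 0) \<in> F" "\<And>J. J \<in> {..<s} \<rightarrow> {..<M} \<Longrightarrow> (\<lambda>x. h * block_sign J x) \<in> F"
    and small: "real N * (\<beta> + a * h)\<^sup>2 +
      real s * (exp (real N * (a\<^sup>2 + (h + a * \<beta>)\<^sup>2) / real s) - 1) / real M \<le> 1 / 2"
  shows "ennreal (\<bar>\<beta>\<bar> / 4) \<le> minimax_risk N (P_class F)"
proof (rule minimax_risk_ge_of_binary_models)
  let ?\<J> = "{..<s} \<rightarrow>\<^sub>E {..<M}"
  show "finite ?\<J>" by (simp add: finite_PiE)
  show "?\<J> \<noteq> {}" using M by (auto simp: PiE_eq_empty_iff)
  show "binary_model a h \<beta> (block_sign J)" for J
    by unfold_locales (use bound a block_sign_cases in auto)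
  show "(\<lambda>x. h * block_sign J x) \<in> F" if "J \<in> ?\<J>" for J
    using F(2)[of J] that by (auto simp: PiE_iff)
  show "(\<Sum>J\<in>?\<J>. \<Sum>K\<in>?\<J>. (1 + (\<beta> + a * h)\<^sup>2 +
      (a\<^sup>2 + (h + a * \<beta>)\<^sup>2) * (\<integral>x. block_sign J x * block_sign K x \<partial>nu)) ^ N)
    \<le> 2 * (real (card ?\<J>))\<^sup>2"
    by (rule block_sign_overlap_sum[OF M _ _ small]) auto
qed (rule F(1))

lemma block_sign_multiple_in_T_class:
  assumes "\<bar>h\<bar> \<le> 3"
  shows "(\<lambda>x. h * block_sign J x) \<in> T_class"
proof -
  interpret binary_model 0 0 0 "block_sign J"
    by unfold_locales (use block_sign_cases in auto)
  show ?thesis by (rule sign_multiple_in_T_class[OF assms])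
qed

text \<open>Each block uses a single coin, that is, a single basis function, and the coefficient of
  that function is \<open>h / sqrt s\<close>. The restriction to the first \<open>m div s\<close> coins keeps its index below \<open>m\<close>.\<close>

lemma block_sign_multiple_in_G_class:
  assumes J: "J \<in> {..<s} \<rightarrow> {..<m div s}" and h: "\<bar>h\<bar> \<le> 3"
  shows "(\<lambda>x. h * block_sign J x) \<in> G_class m s block_basis"
proof -
  define \<alpha> where "\<alpha> j = (if (j - 1) div s = J ((j - 1) mod s) then h / sqrt s else 0)" for j
  have "h * block_sign J x = (\<Sum>j=1..m. \<alpha> j * block_basis j x)" for x
  proof -
    define b where "b = fst (c x)"
    have b: "b < s" using c_range[of x] by (auto simp: b_def)
    define j\<^sub>0 where "j\<^sub>0 = J b * s + b + 1"
    have "J b < m div s" using J b by auto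
    then have "Suc (J b) * s \<le> m div s * s" by (intro mult_right_mono) auto
    also have "\<dots> \<le> m" by simp
    finally have j\<^sub>0: "j\<^sub>0 \<in> {1..m}" using b by (simp add: j\<^sub>0_def)
    have "\<alpha> j * block_basis j x = (if j = j\<^sub>0 then h * block_sign J x else 0)" if "j \<in> {1..m}" for j
    proof (cases "(j - 1) mod s = b \<and> (j - 1) div s = J b")
      case True
      then have "j - 1 = J b * s + b" using div_mult_mod_eq[of "j - 1" s] by simp
      then have "j = j\<^sub>0" using that by (auto simp: j\<^sub>0_def)
      then show ?thesis
        using True s by (simp add: \<alpha>_def block_basis_def block_sign_def b_def[symmetric])
    next
      case False
      then have "j \<noteq> j\<^sub>0" using b by (auto simp: j\<^sub>0_def)
      then show ?thesis using False by (auto simp: \<alpha>_def block_basis_def b_def[symmetric])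
    qed
    then have "(\<Sum>j=1..m. \<alpha> j * block_basis j x) =
        (\<Sum>j=1..m. if j = j\<^sub>0 then h * block_sign J x else 0)"
      by (intro sum.cong) auto
    then show ?thesis using j\<^sub>0 by simp
  qed
  moreover have "l0_norm m \<alpha> \<le> s"
  proof -
    have "inj_on (\<lambda>j. (j - 1) mod s) {j \<in> {1..m}. \<alpha> j \<noteq> 0}"
    proof (rule inj_onI)
      fix i j assume ij: "i \<in> {j \<in> {1..m}. \<alpha> j \<noteq> 0}" "j \<in> {j \<in> {1..m}. \<alpha> j \<noteq> 0}"
        and eq: "(i - 1) mod s = (j - 1) mod s"
      then have "(i - 1) div s = (j - 1) div s" by (auto simp: \<alpha>_def split: if_splits)
      then have "i - 1 = j - 1" using eq by (metis div_mult_mod_eq)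
      then show "i = j" using ij by auto
    qed
    then have "card {j \<in> {1..m}. \<alpha> j \<noteq> 0} \<le> card {..<s}"
      by (rule card_inj_on_le) (use s in auto)
    then show ?thesis by (simp add: l0_norm_def)
  qed
  ultimately show ?thesis
    unfolding G_class_def using block_sign_multiple_in_T_class[OF h] by fastforce
qed

end

lemma coin_cells_exists:
  assumes "s > 0"
  obtains c :: "real ^ 'd::finite \<Rightarrow> nat \<times> nat set" where "coin_cells s R c"
proof -
  have "finite ({..<s} \<times> Pow {..<R})" "{..<s} \<times> Pow {..<R} \<noteq> {}" using assms by auto
  from nu_simulates_uniform[OF this] obtain c :: "real ^ 'd \<Rightarrow> nat \<times> nat set"
    where "c \<in> borel \<rightarrow>\<^sub>M count_space UNIV" "\<And>x. c x \<in> {..<s} \<times> Pow {..<R}"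
      "\<And>f :: nat \<times> nat set \<Rightarrow> real.
        (\<integral>x. f (c x) \<partial>nu) = (\<Sum>k\<in>{..<s} \<times> Pow {..<R}. f k) / card ({..<s} \<times> Pow {..<R})"
    by blast
  then have "coin_cells s R c" using assms by unfold_locales
  then show thesis by (rule that)
qed

section \<open>The three lower bounds\<close>

lemma zero_in_T_class: "(\<lambda>_. 0) \<in> (T_class :: (real ^ 'd::finite \<Rightarrow> real) set)"
proof -
  interpret binary_model 0 0 0 "\<lambda>_ :: real ^ 'd. 1" by unfold_locales auto
  show ?thesis using sign_multiple_in_T_class[of 0] by simp
qed

lemma self_in_T_ball: "g \<in> T_class \<Longrightarrow> 0 \<le> \<delta> \<Longrightarrow> g \<in> T_ball g \<delta>"
  by (simp add: T_ball_def L2_norm_def)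

lemma zero_in_G_class: "(\<lambda>_. 0) \<in> G_class m s \<phi>"
proof -
  have "l0_norm m (\<lambda>_. 0) \<le> s" by (simp add: l0_norm_def)
  then show ?thesis using zero_in_T_class by (auto simp: G_class_def intro!: exI[of _ "\<lambda>_. 0"])
qed

text \<open>With \<open>a = h = 0\<close> the sign function is invisible and a family with one member suffices. The choice
  \<open>\<beta> = 1 / (2 sqrt n)\<close> makes \<open>2 n \<beta>\<^sup>2\<close> equal to \<open>1 / 2\<close>.\<close>

lemma minimax_risk_ge_root_n:
  fixes F :: "(real ^ 'd::finite \<Rightarrow> real) set"
  assumes "n > 0" and F: "(\<lambda>_. 0) \<in> F"
  shows "ennreal (1 / (8 * sqrt n)) \<le> minimax_risk (2 * n) (P_class F)"
proof -
  obtain c :: "real ^ 'd \<Rightarrow> nat \<times> nat set" where "coin_cells 1 1 c"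
    using coin_cells_exists[of 1] by auto
  then interpret coin_cells 1 1 c .
  define \<beta> where "\<beta> = 1 / (2 * sqrt n)"
  have "sqrt n \<ge> 1" using assms(1) by simp
  then have "1 \<le> 2 * sqrt n" by linarith
  then have \<beta>: "0 \<le> \<beta>" "\<beta> \<le> 1" by (auto simp: \<beta>_def divide_le_eq)
  have "ennreal (\<bar>\<beta>\<bar> / 4) \<le> minimax_risk (2 * n) (P_class F)"
  proof (rule minimax_risk_ge_of_block_signs[where M=1 and a=0 and h=0])
    show "real (2 * n) * (\<beta> + 0 * 0)\<^sup>2 +
      real 1 * (exp (real (2 * n) * (0\<^sup>2 + (0 + 0 * \<beta>)\<^sup>2) / real 1) - 1) / real 1 \<le> 1 / 2"
      using assms(1) by (simp add: \<beta>_def power_divide power_mult_distrib)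
  qed (use F \<beta> in auto)
  moreover have "\<bar>\<beta>\<bar> / 4 = 1 / (8 * sqrt n)" using \<beta> by (simp add: \<beta>_def)
  ultimately show ?thesis by simp
qed

text \<open>The functions \<open>h \<xi>\<close> of norm \<open>h = \<delta> / 2\<close> lie in the ball for whatever sign function \<open>\<xi>\<close>.
  Hence the number \<open>M\<close> of coins can be chosen after the sample size, and so large that almost no two random
  choices agree. The effect is \<open>\<beta> = - a h = - \<delta> / 4\<close>, without any loss in \<open>n\<close>.\<close>

lemma minimax_risk_ge_approximation_error:
  fixes F :: "(real ^ 'd::finite \<Rightarrow> real) set"
  assumes \<delta>: "0 \<le> \<delta>" "\<delta> \<le> 1" and F: "T_ball (\<lambda>_. 0) \<delta> \<subseteq> F" "(\<lambda>_. 0) \<in> F"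
  shows "ennreal (\<delta> / 16) \<le> minimax_risk N (P_class F)"
proof -
  interpret nu: prob_space "nu :: (real ^ 'd) measure" by (rule prob_space_nu)
  define a h \<beta> where "a = (1 / 2 :: real)" and "h = \<delta> / 2" and "\<beta> = - \<delta> / 4"
  define \<kappa> where "\<kappa> = a\<^sup>2 + (h + a * \<beta>)\<^sup>2"
  obtain M :: nat where "2 * exp (real N * \<kappa>) \<le> real M"
    using real_arch_simple by blast
  moreover have "0 < 2 * exp (real N * \<kappa>)" by simp
  ultimately have M: "2 * exp (real N * \<kappa>) \<le> real M" "0 < M" by linarith+
  obtain c :: "real ^ 'd \<Rightarrow> nat \<times> nat set" where "coin_cells 1 M c"
    using coin_cells_exists[of 1] by auto
  then interpret coin_cells 1 M c .
  have "ennreal (\<bar>\<beta>\<bar> / 4) \<le> minimax_risk N (P_class F)"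
  proof (rule minimax_risk_ge_of_block_signs[where M=M and a=a and h=h])
    have "(exp (real N * \<kappa>) - 1) / real M \<le> 1 / 2"
      using M by (simp add: divide_le_eq)
    then show "real N * (\<beta> + a * h)\<^sup>2 +
        real 1 * (exp (real N * (a\<^sup>2 + (h + a * \<beta>)\<^sup>2) / real 1) - 1) / real M \<le> 1 / 2"
      unfolding \<kappa>_def[symmetric] by (simp add: \<beta>_def a_def h_def)
    fix J
    have "(\<integral>x. (h * block_sign J x)\<^sup>2 \<partial>nu) = (\<integral>x. h\<^sup>2 \<partial>(nu :: (real ^ 'd) measure))"
    proof (rule Bochner_Integration.integral_cong[OF refl])
      show "(h * block_sign J x)\<^sup>2 = h\<^sup>2" for x
        using block_sign_cases[of J x] by auto
    qed
    then have "L2_norm nu (\<lambda>x. h * block_sign J x - 0) \<le> \<delta>"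
      using \<delta> nu.prob_space by (simp add: L2_norm_def h_def)
    then have "(\<lambda>x. h * block_sign J x) \<in> T_ball (\<lambda>_. 0) \<delta>"
      using block_sign_multiple_in_T_class[of h J] \<delta> by (simp add: T_ball_def h_def)
    then show "(\<lambda>x. h * block_sign J x) \<in> F" using F by blast
  qed (use \<delta> M F in \<open>auto simp: a_def h_def \<beta>_def power2_eq_square\<close>)
  then show ?thesis using \<delta> by (simp add: \<beta>_def)
qed

text \<open>With \<open>w = q powr (1/4)\<close> the hypotheses give \<open>n \<le> w\<^sup>2\<close> and \<open>4 \<le> w\<close>, and the claim is
  \<open>4 n w \<le> w ^ 4\<close>. It says that a fourth root of \<open>m / s\<close> leaves room for a factor \<open>n \<ge> s\<close>.\<close>

lemma four_mul_exp_quarter_ln_le: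
  fixes q :: real and n :: nat
  assumes "16 \<le> n" "(real n)\<^sup>2 \<le> q"
  shows "4 * real n * exp (ln q / 4) \<le> q"
proof -
  define w where "w = exp (ln q / 4)"
  have "0 < (real n)\<^sup>2" using assms(1) by simp
  then have "0 < q" using assms(2) by linarith
  then have w4: "w ^ 4 = q" by (simp add: w_def exp_of_nat_mult[symmetric])
  have "(real n)\<^sup>2 \<le> (w\<^sup>2)\<^sup>2" using w4 assms(2) by (simp add: power_mult[symmetric])
  then have n: "real n \<le> w\<^sup>2" by (rule power2_le_imp_le) simp
  then have "4\<^sup>2 \<le> w\<^sup>2" using assms(1) by simp
  then have "4 \<le> w" by (rule power2_le_imp_le) (simp add: w_def)
  then have "4 * real n * w \<le> w * w\<^sup>2 * w"
    using n by (intro mult_right_mono mult_mono) auto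
  also have "\<dots> = q" using w4 by (simp add: power2_eq_square power4_eq_xxxx mult_ac)
  finally show ?thesis by (simp add: w_def)
qed

text \<open>The choice \<open>a\<^sup>2 = S / 16\<close> gives \<open>\<kappa> \<le> S / 8\<close>, hence \<open>2 n \<kappa> / s \<le> ln (m / s) / 4\<close>. Thus
  the agreement factor \<open>z\<close> is at most the fourth root of \<open>m / s\<close>, while the number of coins per block is at
  least \<open>m / (2 s)\<close>.\<close>

lemma (in coin_cells) minimax_risk_ge_sparsity:
  fixes n m :: nat
  defines "S \<equiv> real s * ln (real m / real s) / real n"
  assumes n: "16 \<le> n" and R: "m div s \<le> R" and sm: "s \<le> m" "s \<le> n" "n\<^sup>2 * s \<le> m" and S: "S \<le> 1"
    and F: "(\<lambda>_. 0) \<in> F" "\<And>h J. \<bar>h\<bar> \<le> 3 \<Longrightarrow> J \<in> {..<s} \<rightarrow> {..<m div s} \<Longrightarrow> (\<lambda>x. h * block_sign J x) \<in> F"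
  shows "ennreal (S / 64) \<le> minimax_risk (2 * n) (P_class F)"
proof -
  define q where "q = real m / real s"
  define M where "M = m div s"
  have "real (n\<^sup>2 * s) \<le> real m" using sm(3) by (simp only: of_nat_le_iff)
  then have q: "(real n)\<^sup>2 \<le> q" using s by (simp add: q_def le_divide_eq)
  moreover have "16\<^sup>2 \<le> (real n)\<^sup>2" using n by (intro power_mono) auto
  ultimately have q2: "2 \<le> q" by simp
  have "m < (M + 1) * s"
    using dividend_less_div_times[OF s, of m] by (simp add: M_def)
  then have "real m < real ((M + 1) * s)" by (simp only: of_nat_less_iff)
  then have "q < real M + 1"
    using s by (simp add: q_def divide_less_eq algebra_simps)
  then have M: "q / 2 \<le> real M" using q2 by linarith
  then have M0: "0 < M" using q2 by (intro gr0I) simp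
  have S0: "0 \<le> S" using q2 by (simp add: S_def q_def[symmetric])
  define a where "a = sqrt (S / 16)"
  have a2: "a\<^sup>2 = S / 16" using S0 by (simp add: a_def)
  have "a\<^sup>2 \<le> (1 / 4)\<^sup>2" using S by (simp add: a2 power_divide)
  then have "a \<le> 1 / 4" by (rule power2_le_imp_le) simp
  moreover have "0 \<le> a" using S0 by (simp add: a_def)
  ultimately have a_bounds: "0 \<le> a" "a \<le> 1 / 4" by simp_all
  define \<beta> where "\<beta> = - a\<^sup>2"
  define \<kappa> where "\<kappa> = a\<^sup>2 + (a + a * \<beta>)\<^sup>2"
  have "ennreal (\<bar>\<beta>\<bar> / 4) \<le> minimax_risk (2 * n) (P_class F)"
  proof (rule minimax_risk_ge_of_block_signs[where M=M and a=a and h=a])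
    have "0 \<le> a * (1 - a\<^sup>2)" "a * (1 - a\<^sup>2) \<le> a"
      using a_bounds S S0 a2 by (auto intro!: mult_nonneg_nonneg mult_left_le)
    then have "(a + a * \<beta>)\<^sup>2 \<le> a\<^sup>2"
      by (intro power_mono) (auto simp: \<beta>_def algebra_simps)
    then have "\<kappa> \<le> S / 8" using a2 by (simp add: \<kappa>_def)
    then have "real (2 * n) * \<kappa> / real s \<le> real (2 * n) * (S / 8) / real s"
      by (intro divide_right_mono mult_left_mono) auto
    also have "\<dots> = ln q / 4" using n s by (simp add: S_def q_def)
    finally have "exp (real (2 * n) * \<kappa> / real s) \<le> exp (ln q / 4)" by simp
    then have le: "exp (real (2 * n) * \<kappa> / real s) - 1 \<le> exp (ln q / 4)" by linarith
    have "0 \<le> \<kappa>" by (simp add: \<kappa>_def)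
    then have "0 \<le> exp (real (2 * n) * \<kappa> / real s) - 1" by simp
    then have "real s * (exp (real (2 * n) * \<kappa> / real s) - 1) \<le> real n * exp (ln q / 4)"
      using sm(2) by (intro mult_mono le) auto
    also have "\<dots> \<le> q / 4" using four_mul_exp_quarter_ln_le[OF n q] by simp
    also have "\<dots> \<le> real M / 2" using M by simp
    finally have "real s * (exp (real (2 * n) * \<kappa> / real s) - 1) / real M \<le> 1 / 2"
      using M0 by (simp add: divide_le_eq)
    moreover have "\<beta> + a * a = 0" by (simp add: \<beta>_def power2_eq_square)
    ultimately show "real (2 * n) * (\<beta> + a * a)\<^sup>2 +
        real s * (exp (real (2 * n) * (a\<^sup>2 + (a + a * \<beta>)\<^sup>2) / real s) - 1) / real M \<le> 1 / 2"
      unfolding \<kappa>_def[symmetric] by simp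
    show "\<bar>\<beta>\<bar> + \<bar>a\<bar> \<le> 1" using a_bounds S S0 by (simp add: \<beta>_def a2)
    show "a\<^sup>2 \<le> 2 / 3" using S by (simp add: a2)
    show "M \<le> R" using R by (simp add: M_def)
    show "(\<lambda>x. a * block_sign J x) \<in> F" if "J \<in> {..<s} \<rightarrow> {..<M}" for J
      by (rule F(2)) (use that a_bounds in \<open>auto simp: M_def\<close>)
  qed (use M0 F in auto)
  then show ?thesis using S0 by (simp add: \<beta>_def a2)
qed

theorem proposition2:
  fixes \<delta> :: real and n m s :: nat
  assumes "0 \<le> \<delta>" and "\<delta> \<le> 1" and "n \<ge> 18" and "m \<ge> 1" and "s \<ge> 1" and "m \<ge> n ^ 3"
    and "real s * (ln (real m / real s) + 1) / real n \<le> 1"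
  shows "\<exists>\<phi> :: nat \<Rightarrow> real ^ 'd \<Rightarrow> real.
    orthonormal_basis_functions m \<phi> \<and>
    minimax_risk (2 * n) (P_class (F_class m s \<delta> \<phi>)) \<ge>
      ennreal (1 / 211 * (real n powr (- 1 / 2) + \<delta> + real s * ln (real m / real s) / real n))"
proof -
  obtain c :: "real ^ 'd \<Rightarrow> nat \<times> nat set" where "coin_cells s m c"
    using coin_cells_exists[of s m] assms(5) by auto
  then interpret coin_cells s m c .
  define F where "F = F_class m s \<delta> block_basis"
  define r where "r = minimax_risk (2 * n) (P_class F)"
  define S where "S = real s * ln (real m / real s) / real n"
  have GF: "G_class m s block_basis \<subseteq> F"
    using self_in_T_ball assms(1) by (auto simp: F_def F_class_def G_class_def)
  then have zero: "(\<lambda>_. 0) \<in> F" using zero_in_G_class by blast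
  have root_n: "ennreal (1 / (8 * sqrt n)) \<le> r"
    unfolding r_def by (rule minimax_risk_ge_root_n) (use assms(3) zero in auto)
  have approximation: "ennreal (\<delta> / 16) \<le> r"
    unfolding r_def
  proof (rule minimax_risk_ge_approximation_error[OF assms(1,2) _ zero])
    show "T_ball (\<lambda>_. 0) \<delta> \<subseteq> F" using zero_in_G_class by (auto simp: F_def F_class_def)
  qed
  have sparsity: "ennreal (S / 64) \<le> r"
  proof (cases "s \<le> m")
    case True
    have n0: "0 < real n" using assms(3) by simp
    have "0 \<le> ln (real m / real s)" using True s by simp
    then have sl: "0 \<le> real s * ln (real m / real s)" by simp
    have le: "real s * ln (real m / real s) + real s \<le> real n"
      using assms(7) n0 by (simp add: divide_le_eq algebra_simps)
    then have sn: "s \<le> n" using sl by linarith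
    have "n\<^sup>2 * s \<le> n\<^sup>2 * n" using sn by simp
    also have "\<dots> \<le> m" using assms(6) by (simp add: power2_eq_square power3_eq_cube)
    finally have "n\<^sup>2 * s \<le> m" .
    moreover have "S \<le> 1" using le n0 by (simp add: S_def divide_le_eq)
    moreover have "(\<lambda>x. h * block_sign J x) \<in> F" if "\<bar>h\<bar> \<le> 3" "J \<in> {..<s} \<rightarrow> {..<m div s}" for h J
      using block_sign_multiple_in_G_class[OF that(2,1)] GF by blast
    ultimately show ?thesis
      unfolding r_def S_def
      by (intro minimax_risk_ge_sparsity) (use assms(3) True sn zero in \<open>auto intro: div_le_dividend\<close>)
  next
    case False
    \<comment> \<open>For \<open>s > m\<close> the hypothesis does not bound \<open>s\<close> by \<open>n\<close>, but then the logarithm is negative.\<close>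
    then have "ln (real m / real s) \<le> 0" using assms(4) s by simp
    then have "S \<le> 0" by (simp add: S_def mult_nonneg_nonpos divide_nonpos_nonneg)
    then show ?thesis by (simp add: ennreal_neg)
  qed
  \<comment> \<open>The three bounds add up to \<open>8 + 16 + 64 = 88\<close> times the risk.\<close>
  have "ennreal (1 / 211 * (real n powr (- 1 / 2) + \<delta> + S)) \<le> r"
  proof (cases r)
    case (real \<rho>)
    have \<rho>: "1 / (8 * sqrt n) \<le> \<rho>" "\<delta> / 16 \<le> \<rho>" "S / 64 \<le> \<rho>"
      using root_n approximation sparsity real assms(1) by (auto simp: ennreal_le_iff)
    have "real n powr (- 1 / 2) = 1 / sqrt n"
      using powr_minus_divide[of "real n" "1 / 2"] by (simp add: powr_half_sqrt)
    also have "\<dots> \<le> 8 * \<rho>" using \<rho>(1) by simp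
    finally have "real n powr (- 1 / 2) + \<delta> + S \<le> 8 * \<rho> + 16 * \<rho> + 64 * \<rho>"
      using \<rho>(2,3) by (intro add_mono) simp_all
    also have "\<dots> \<le> 211 * \<rho>" using real(1) by simp
    finally have "1 / 211 * (real n powr (- 1 / 2) + \<delta> + S) \<le> \<rho>" by simp
    then show ?thesis unfolding real(2) by (rule ennreal_leI)
  qed simp
  then show ?thesis
    using orthonormal_block_basis[of m] unfolding r_def F_def S_def by auto
qed

end
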